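(* Let $L,H>0$, $D_0,\mu_0>0$ and $M>\max(D_0,\mu_0)$. There is a threshold $k_0$ (depending only on $D_0,\mu_0,M,L,H$) such that for all integers $k_0\le k_1<k_2$ there exists a constant $C>0$ depending only on $\mu_0,D_0,k_1,k_2,M,L,H$ with the following property. For all $(D,\mu_a),(\tilde D,\tilde\mu_a)\in\mathcal O_M$ satisfying $D(H)=\tilde D(H)$, $D'(H)=\tilde D'(H)$, $\mu_a'(H)=\tilde\mu_a'(H)$, one has $$\|\underline u_m^2(D-\tilde D)\|_{C^0}\le C\big(\|h_1-\tilde h_1\|_{C^1}+\|h_2-\tilde h_2\|_{C^1}\big),$$ $$\|\underline u_m^2(\mu_a-\tilde\mu_a)\|_{C^0}\le C\big(\|h_1-\tilde h_1\|_{C^1}+\|h_2-\tilde h_2\|_{C^1}\big),$$ where $h_i=\mu_au_{k_i}$, $\tilde h_i=\tilde\mu_a\tilde u_{k_i}$ ($i=1,2$), and $$\underline u_m(y)=\frac{D^{1/2}(H)}{D^{1/2}(y)}\,\frac{\sinh(\kappa_m^{1/2}y)}{\sinh(\kappa_m^{1/2}H)},\qquad \kappa_m=\min_{0\le y\le H}\Big(\frac{(D^{1/2})''}{D^{1/2}}+\frac{\mu_a}{D}+\lambda_{k_1}^2\Big).$$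
   Context: $\mathcal O_M=\{(D,\mu)\in C^3([0,H])^2:\ D>D_0,\ \mu>\mu_0,\ \|D\|_{C^3},\|\mu\|_{C^3}\le M\}$. $\lambda_k=2k\pi/L$. For $(D,\mu_a)\in\mathcal O_M$ and an integer $k$, $u_k$ is the unique solution of $$-(D(y)u'(y))'+(\mu_a(y)+\lambda_k^2D(y))u(y)=0\ \text{ on }(0,H),\qquad u(H)=1,\ u(0)=0,$$ and $\tilde u_k$ is the solution with $(\tilde D,\tilde\mu_a)$ in place of $(D,\mu_a)$. The norms $C^0$, $C^1$ are those of $C^0([0,H])$, $C^1([0,H])$. *)

theory Defs
  imports "HOL-Analysis.Analysis"
begin

(* Functions on [0,H] are total functions whose values outside {0..H} are irrelevant: the
   derivative is taken within {0..H}, hence one-sided at the two end points. *)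
definition deriv_on :: "real \<Rightarrow> (real \<Rightarrow> real) \<Rightarrow> real \<Rightarrow> real" where
  "deriv_on H f y = vector_derivative f (at y within {0..H})"

definition Ck :: "nat \<Rightarrow> real \<Rightarrow> (real \<Rightarrow> real) set" where
  "Ck k H = {f. (\<forall>j<k. (deriv_on H ^^ j) f differentiable_on {0..H}) \<and>
                continuous_on {0..H} ((deriv_on H ^^ k) f)}"

(* Meaningful for f in Ck k H with H >= 0, where every supremum is a maximum. *)
definition Ck_norm :: "nat \<Rightarrow> real \<Rightarrow> (real \<Rightarrow> real) \<Rightarrow> real" where
  "Ck_norm k H f = (\<Sum>j\<le>k. SUP y\<in>{0..H}. \<bar>(deriv_on H ^^ j) f y\<bar>)"

definition admissible :: "real \<Rightarrow> real \<Rightarrow> real \<Rightarrow> real \<Rightarrow> ((real \<Rightarrow> real) \<times> (real \<Rightarrow> real)) set" where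
  "admissible H D\<^sub>0 \<mu>\<^sub>0 M =
     {(D, \<mu>). D \<in> Ck 3 H \<and> \<mu> \<in> Ck 3 H \<and>
        (\<forall>y\<in>{0..H}. D y > D\<^sub>0) \<and> (\<forall>y\<in>{0..H}. \<mu> y > \<mu>\<^sub>0) \<and>
        Ck_norm 3 H D \<le> M \<and> Ck_norm 3 H \<mu> \<le> M}"

definition freq :: "real \<Rightarrow> int \<Rightarrow> real" where
  "freq L k = 2 * of_int k * pi / L"

(* Classical solutions, continuous up to the boundary; such a u is determined on {0..H} only. *)
definition bvp_solution ::
    "real \<Rightarrow> (real \<Rightarrow> real) \<Rightarrow> (real \<Rightarrow> real) \<Rightarrow> real \<Rightarrow> (real \<Rightarrow> real) \<Rightarrow> bool" where
  "bvp_solution H D \<mu> l u \<longleftrightarrow>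
     continuous_on {0..H} u \<and>
     u differentiable_on {0<..<H} \<and>
     (\<lambda>y. D y * deriv u y) differentiable_on {0<..<H} \<and>
     (\<forall>y\<in>{0<..<H}. - deriv (\<lambda>z. D z * deriv u z) y + (\<mu> y + l\<^sup>2 * D y) * u y = 0) \<and>
     u H = 1 \<and> u 0 = 0"

(* For D and mu as in admissible the function is continuous on {0..H}, so INF is a minimum. *)
definition kappa_m :: "real \<Rightarrow> (real \<Rightarrow> real) \<Rightarrow> (real \<Rightarrow> real) \<Rightarrow> real \<Rightarrow> real" where
  "kappa_m H D \<mu> l =
     (INF y\<in>{0..H}. (deriv_on H ^^ 2) (\<lambda>z. sqrt (D z)) y / sqrt (D y) + \<mu> y / D y + l\<^sup>2)"

definition u_m :: "real \<Rightarrow> (real \<Rightarrow> real) \<Rightarrow> (real \<Rightarrow> real) \<Rightarrow> real \<Rightarrow> real \<Rightarrow> real" where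
  "u_m H D \<mu> l y =
     sqrt (D H) / sqrt (D y) *
     (sinh (sqrt (kappa_m H D \<mu> l) * y) / sinh (sqrt (kappa_m H D \<mu> l) * H))"

end

theory Submission
  imports Defs
begin

text \<open>
  Write \<open>g = D u'\<close> for the flux of a solution and \<open>h = \<mu> u\<close> for its datum. For the two frequencies the
  weighted Wronskian \<open>W = u\<^sub>1 g\<^sub>2 - u\<^sub>2 g\<^sub>1\<close> satisfies \<open>W' / W = (\<lambda>\<^sub>2\<^sup>2 - \<lambda>\<^sub>1\<^sup>2) h\<^sub>1 h\<^sub>2 / J\<close>, where \<open>J\<close> is the
  Wronskian of the data, and \<open>a = D u\<^sub>1\<^sup>2 = W h\<^sub>1\<^sup>2 / J\<close>; so \<open>a\<close> is determined by first derivatives of the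
  data. Then \<open>p = 1 / u\<^sub>1\<close> and \<open>r = - g\<^sub>1\<close> solve the linear system \<open>p' = r / a\<close>, \<open>r' = - \<lambda>\<^sub>1\<^sup>2 a p - h\<^sub>1\<close>
  with known values at \<open>H\<close>, and \<open>D = a p\<^sup>2\<close>, \<open>\<mu> = h\<^sub>1 p\<close>. Every solution is comparable to \<open>y\<close>, so
  \<open>a ~ y\<^sup>2\<close> and \<open>W, J ~ y\<^sup>3\<close>; data at distance \<open>e\<close> give \<open>a\<close> up to \<open>O(e)\<close> and \<open>p\<close> up to \<open>O(e / y\<^sup>3)\<close>,
  hence \<open>D\<close> and \<open>\<mu>\<close> up to \<open>O(e / y\<^sup>2)\<close>. The weight \<open>u_m\<close> is \<open>O(y)\<close> because \<open>sinh\<close> is convex on the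
  positive half line, whatever the sign of \<open>\<kappa>_m\<close>.
\<close>

section \<open>Mean value inequalities and a bound for quotients of sinh\<close>

text \<open>The mean value theorem for \<open>g - f\<close>. Derivatives are taken within a larger
  set \<open>S\<close> so that the one-sided derivatives on \<open>{0..H}\<close> can be used on
  every subinterval.\<close>

lemma deriv_le_imp_diff_le:
  fixes f g :: "real \<Rightarrow> real"
  assumes "a \<le> b" "{a..b} \<subseteq> S"
    and f: "\<And>x. x \<in> {a..b} \<Longrightarrow> (f has_real_derivative f' x) (at x within S)"
    and g: "\<And>x. x \<in> {a..b} \<Longrightarrow> (g has_real_derivative g' x) (at x within S)"
    and le: "\<And>x. x \<in> {a..b} \<Longrightarrow> f' x \<le> g' x"
  shows "f b - f a \<le> g b - g a"
proof (cases "a = b")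
  case False
  with assms have "a < b" by simp
  have "((\<lambda>x. g x - f x) has_derivative (*) (g' x - f' x)) (at x within {a..b})" if "a \<le> x" "x \<le> b" for x
    using DERIV_subset[OF DERIV_diff[OF g f] assms(2)] that
    by (simp add: has_field_derivative_def)
  from mvt_simple[OF \<open>a < b\<close> this] obtain x where "x \<in> {a<..<b}"
    and x: "(g b - f b) - (g a - f a) = (g' x - f' x) * (b - a)" by auto
  then have "0 \<le> (g' x - f' x) * (b - a)" using le[of x] \<open>a < b\<close> by simp
  with x show ?thesis by linarith
qed simp

lemma abs_deriv_le_imp_abs_diff_le:
  fixes f g :: "real \<Rightarrow> real"
  assumes "a \<le> b" "{a..b} \<subseteq> S"
    and f: "\<And>x. x \<in> {a..b} \<Longrightarrow> (f has_real_derivative f' x) (at x within S)"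
    and g: "\<And>x. x \<in> {a..b} \<Longrightarrow> (g has_real_derivative g' x) (at x within S)"
    and le: "\<And>x. x \<in> {a..b} \<Longrightarrow> \<bar>f' x\<bar> \<le> g' x"
  shows "\<bar>f b - f a\<bar> \<le> g b - g a"
proof -
  have "f b - f a \<le> g b - g a"
    by (rule deriv_le_imp_diff_le[OF assms(1,2) f g]) (use le in \<open>auto simp: abs_le_iff\<close>)
  moreover have "(- f b) - (- f a) \<le> g b - g a"
    by (rule deriv_le_imp_diff_le[OF assms(1,2) DERIV_minus[OF f] g]) (use le in \<open>auto simp: abs_le_iff\<close>)
  ultimately show ?thesis by linarith
qed

lemma abs_mult_le:
  fixes x y :: real
  shows "\<bar>x\<bar> \<le> a \<Longrightarrow> \<bar>y\<bar> \<le> b \<Longrightarrow> \<bar>x * y\<bar> \<le> a * b"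
  by (auto simp: abs_mult intro!: mult_mono)

lemma abs_divide_le:
  fixes x y :: real
  shows "\<bar>x\<bar> \<le> a \<Longrightarrow> 0 < b \<Longrightarrow> b \<le> y \<Longrightarrow> \<bar>x / y\<bar> \<le> a / b"
  by (auto simp: abs_divide intro!: frac_le)

text \<open>Both sides are compared as functions of the scale \<open>t\<close>: they vanish at
  \<open>t = 0\<close>, and \<open>cosh\<close> increases on the nonnegative half line. Negative
  \<open>s\<close> follows by oddness and \<open>s = 0\<close> from \<open>0 / 0 = 0\<close>; these
  cases matter because \<open>sqrt\<close> of a negative real is negative.\<close>

lemma sinh_ratio_le:
  fixes s y H :: real
  assumes "0 < H" "0 \<le> y" "y \<le> H"
  shows "0 \<le> sinh (s * y) / sinh (s * H)" "sinh (s * y) / sinh (s * H) \<le> y / H"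
proof -
  have *: "0 \<le> sinh (t * y) / sinh (t * H) \<and> sinh (t * y) / sinh (t * H) \<le> y / H" if "t > 0" for t
  proof -
    have "sinh (H * t) * (y / H) - sinh (H * 0) * (y / H) \<ge> sinh (y * t) - sinh (y * 0)"
    proof (rule deriv_le_imp_diff_le[where S = UNIV])
      fix x assume "x \<in> {0..t}"
      show "((\<lambda>x. sinh (y * x)) has_real_derivative y * cosh (y * x)) (at x)"
        by (auto intro!: derivative_eq_intros)
      show "((\<lambda>x. sinh (H * x) * (y / H)) has_real_derivative y * cosh (H * x)) (at x)"
        using assms by (auto intro!: derivative_eq_intros)
      show "y * cosh (y * x) \<le> y * cosh (H * x)"
        using assms \<open>x \<in> _\<close> by (intro mult_left_mono) (auto simp: cosh_real_nonneg_le_iff mult_right_mono)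
    qed (use that in auto)
    then show ?thesis using assms that by (auto simp: field_simps)
  qed
  show "0 \<le> sinh (s * y) / sinh (s * H)" "sinh (s * y) / sinh (s * H) \<le> y / H"
    using *[of s] *[of "-s"] assms by (cases s "0::real" rule: linorder_cases; simp)+
qed

section \<open>Derivatives and norms on the closed interval\<close>

lemma deriv_on_eqI:
  assumes "0 < H" "y \<in> {0..H}" "(f has_real_derivative d) (at y within {0..H})"
  shows "deriv_on H f y = d"
  unfolding deriv_on_def
  using assms vector_derivative_within_closed_interval[of 0 H y f d]
  by (simp add: has_real_derivative_iff_has_vector_derivative)

lemma Ck_continuous:
  assumes "f \<in> Ck k H" "j \<le> k"
  shows "continuous_on {0..H} ((deriv_on H ^^ j) f)"
  using assms unfolding Ck_def by (cases "j = k") (auto intro: differentiable_imp_continuous_on)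

lemma Ck_has_derivative:
  assumes "0 < H" "f \<in> Ck k H" "0 < k" "y \<in> {0..H}"
  shows "(f has_real_derivative deriv_on H f y) (at y within {0..H})"
proof -
  have "f differentiable_on {0..H}" using assms unfolding Ck_def by force
  with assms show ?thesis
    unfolding deriv_on_def has_real_derivative_iff_has_vector_derivative differentiable_on_def
    using vector_derivative_works by blast
qed

lemma Ck_norm_ge:
  assumes "0 < H" "f \<in> Ck k H" "j \<le> k" "y \<in> {0..H}"
  shows "\<bar>(deriv_on H ^^ j) f y\<bar> \<le> Ck_norm k H f"
proof -
  let ?s = "\<lambda>j. SUP y\<in>{0..H}. \<bar>(deriv_on H ^^ j) f y\<bar>"
  have ub: "\<bar>(deriv_on H ^^ i) f x\<bar> \<le> ?s i" if "i \<le> k" "x \<in> {0..H}" for i x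
  proof (rule cSUP_upper[OF that(2)])
    have "compact ((\<lambda>y. \<bar>(deriv_on H ^^ i) f y\<bar>) ` {0..H})"
      using Ck_continuous[OF assms(2) that(1)]
      by (intro compact_continuous_image continuous_intros) auto
    then show "bdd_above ((\<lambda>y. \<bar>(deriv_on H ^^ i) f y\<bar>) ` {0..H})"
      by (intro bounded_imp_bdd_above compact_imp_bounded)
  qed
  have "0 \<le> ?s i" if "i \<le> k" for i
    using ub[OF that, of 0] assms(1) by (auto intro: order_trans[OF abs_ge_zero])
  then have "?s j \<le> Ck_norm k H f"
    unfolding Ck_norm_def using assms(3) by (intro member_le_sum) auto
  with ub[OF assms(3,4)] show ?thesis by linarith
qed

section \<open>The boundary value problem as a first-order system\<close>

text \<open>The flux extends to the closed interval because its derivative does.\<close>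

lemma bvp_solution_flux:
  assumes "0 < H" and D: "continuous_on {0..H} D" "\<And>y. y \<in> {0..H} \<Longrightarrow> 0 < D y"
    and m: "continuous_on {0..H} m" and sol: "bvp_solution H D m l u"
  obtains g where
    "\<And>y. y \<in> {0..H} \<Longrightarrow> (u has_real_derivative g y / D y) (at y within {0..H})"
    "\<And>y. y \<in> {0..H} \<Longrightarrow> (g has_real_derivative (m y + l\<^sup>2 * D y) * u y) (at y within {0..H})"
proof -
  let ?q = "\<lambda>y. (m y + l\<^sup>2 * D y) * u y"
  let ?I = "\<lambda>y. integral {0..y} ?q"
  let ?F = "\<lambda>y. D y * deriv u y"
  have u: "continuous_on {0..H} u" and du: "u differentiable_on {0<..<H}"
    and dF: "?F differentiable_on {0<..<H}"
    and eq: "\<And>y. y \<in> {0<..<H} \<Longrightarrow> deriv ?F y = ?q y"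
    using sol unfolding bvp_solution_def by force+
  have q: "continuous_on {0..H} ?q" using D m u by (intro continuous_intros)
  have I: "(?I has_real_derivative ?q y) (at y within {0..H})" if "y \<in> {0..H}" for y
    using integral_has_vector_derivative[OF q that]
    by (simp add: has_real_derivative_iff_has_vector_derivative)
  have real_diff: "(f has_real_derivative deriv f y) (at y)"
    if "f differentiable_on {0<..<H}" "y \<in> {0<..<H}" for f y
    using that by (meson DERIV_deriv_iff_real_differentiable differentiable_on_eq_differentiable_at
        open_greaterThanLessThan)
  \<comment> \<open>Inside the interval the flux differs from the integral of its derivative by a
    constant \<open>c\<close>; the integral plus \<open>c\<close> is the extension
    \<open>g\<close>.\<close>
  have "((\<lambda>y. ?F y - ?I y) has_real_derivative 0) (at y within {0<..<H})" if "y \<in> {0<..<H}" for y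
  proof -
    have "(?F has_real_derivative ?q y) (at y within {0<..<H})"
      using real_diff[OF dF that] eq[OF that] by (simp add: has_field_derivative_at_within)
    moreover have "(?I has_real_derivative ?q y) (at y within {0<..<H})"
      using that by (intro DERIV_subset[OF I]) auto
    ultimately show ?thesis using DERIV_diff by fastforce
  qed
  then obtain c where c: "\<And>y. y \<in> {0<..<H} \<Longrightarrow> ?F y - ?I y = c"
    using has_field_derivative_zero_constant[of "{0<..<H}" "\<lambda>y. ?F y - ?I y"] by auto
  define g where "g = (\<lambda>y. ?I y + c)"
  have g: "(g has_real_derivative ?q y) (at y within {0..H})" if "y \<in> {0..H}" for y
    unfolding g_def using I[OF that] by (auto intro!: derivative_eq_intros)
  then have "continuous_on {0..H} g"
    by (rule DERIV_continuous_on)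
  then have gD: "continuous_on {0..H} (\<lambda>y. g y / D y)"
    using D by (intro continuous_on_divide) force+
  \<comment> \<open>The fundamental theorem asks for derivatives only in the interior and for
    continuity of \<open>u\<close> up to the boundary. The integral representation then yields the
    one-sided derivatives at both end points.\<close>
  have u_int: "u y = u 0 + integral {0..y} (\<lambda>y. g y / D y)" if "y \<in> {0..H}" for y
  proof -
    have "((\<lambda>y. g y / D y) has_integral u y - u 0) {0..y}"
    proof (rule fundamental_theorem_of_calculus_interior)
      show "continuous_on {0..y} u" using that by (intro continuous_on_subset[OF u]) auto
      fix x assume "x \<in> {0<..<y}"
      then have x: "x \<in> {0<..<H}" using that by auto
      have "deriv u x = g x / D x" using c[OF x] D(2)[of x] x by (simp add: g_def field_simps)
      then show "(u has_vector_derivative g x / D x) (at x)"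
        using real_diff[OF du x] by (simp add: has_real_derivative_iff_has_vector_derivative)
    qed (use that in auto)
    then show ?thesis by (simp add: integral_unique)
  qed
  have "(u has_real_derivative g y / D y) (at y within {0..H})" if "y \<in> {0..H}" for y
  proof -
    have "((\<lambda>y. u 0 + integral {0..y} (\<lambda>y. g y / D y)) has_real_derivative g y / D y) (at y within {0..H})"
      using integral_has_vector_derivative[OF gD that]
      by (auto simp: has_real_derivative_iff_has_vector_derivative intro!: derivative_eq_intros)
    then show ?thesis
      by (rule has_field_derivative_transform_within[OF _ zero_less_one that]) (rule u_int[symmetric])
  qed
  with g that show ?thesis by blast
qed

text \<open>One \<open>C\<close> has to serve all coefficients and solutions at once; this
  uniformity makes the final constant depend on the a priori data alone. \<open>s\<close> stands for
  a squared frequency.\<close>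

definition flux_bound :: "real \<Rightarrow> real \<Rightarrow> real \<Rightarrow> real \<Rightarrow> real \<Rightarrow> bool" where
  "flux_bound H D\<^sub>0 M s C \<longleftrightarrow> (\<forall>D m u g.
      (\<forall>y\<in>{0..H}. D\<^sub>0 \<le> D y \<and> D y \<le> M \<and> 0 \<le> m y \<and> m y \<le> M \<and>
        (u has_real_derivative g y / D y) (at y within {0..H}) \<and>
        (g has_real_derivative (m y + s * D y) * u y) (at y within {0..H})) \<and> u 0 = 0 \<and> u H = 1
      \<longrightarrow> (\<forall>y\<in>{0..H}. y \<le> C * u y \<and> u y \<le> C * y \<and> \<bar>g y\<bar> \<le> C))"

text \<open>Nonnegative coefficients make \<open>g\<close> nonnegative and increasing. An upper
  bound for \<open>g\<close> comes from a mean value point of \<open>u\<close>, a positive lower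
  bound at \<open>0\<close> from a Gronwall argument; integrating \<open>g / D\<close> then makes
  \<open>u\<close> comparable to \<open>y\<close>.\<close>

lemma ex_flux_bound:
  fixes H D\<^sub>0 M s :: real
  assumes "0 < H" "0 < D\<^sub>0" "D\<^sub>0 \<le> M" "0 \<le> s"
  shows "\<exists>C. flux_bound H D\<^sub>0 M s C"
proof -
  \<comment> \<open>\<open>B\<close> bounds \<open>m + s * D\<close>. In \<open>G\<close>, the term
    \<open>M / H\<close> bounds the flux at a mean value point and \<open>B * H\<close> its growth
    from there. \<open>K\<close> is the exponential rate of \<open>g + u\<close>.\<close>
  define B where "B = M + s * M"
  define G where "G = M / H + B * H"
  define K where "K = B + 1 / D\<^sub>0"
  define C where "C = G + G / D\<^sub>0 + M * exp (K * H)"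
  have B: "0 \<le> B" and G: "0 \<le> G" using assms by (auto simp: B_def G_def)
  show ?thesis
    unfolding flux_bound_def
  proof (intro exI[of _ C] allI impI ballI, elim conjE)
    fix D m u g :: "real \<Rightarrow> real" and y
    assume *: "\<forall>y\<in>{0..H}. D\<^sub>0 \<le> D y \<and> D y \<le> M \<and> 0 \<le> m y \<and> m y \<le> M \<and>
        (u has_real_derivative g y / D y) (at y within {0..H}) \<and>
        (g has_real_derivative (m y + s * D y) * u y) (at y within {0..H})"
      and bc: "u 0 = 0" "u H = 1" and y: "y \<in> {0..H}"
    then have D: "\<And>y. y \<in> {0..H} \<Longrightarrow> D\<^sub>0 \<le> D y \<and> D y \<le> M"
      and m: "\<And>y. y \<in> {0..H} \<Longrightarrow> 0 \<le> m y \<and> m y \<le> M"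
      and u: "\<And>y. y \<in> {0..H} \<Longrightarrow> (u has_real_derivative g y / D y) (at y within {0..H})"
      and g: "\<And>y. y \<in> {0..H} \<Longrightarrow> (g has_real_derivative (m y + s * D y) * u y) (at y within {0..H})"
      by blast+
    have Dpos: "0 < D x" if "x \<in> {0..H}" for x using D[OF that] assms by linarith
    have q: "0 \<le> m x + s * D x" "m x + s * D x \<le> B" if "x \<in> {0..H}" for x
      using m[OF that] D[OF that] Dpos[OF that] assms by (auto simp: B_def intro!: add_mono mult_left_mono)
    have mono: "f a \<le> f b"
      if "\<And>x. x \<in> {0..H} \<Longrightarrow> (f has_real_derivative f' x) (at x within {0..H})"
        "\<And>x. x \<in> {0..H} \<Longrightarrow> 0 \<le> f' x" "0 \<le> a" "a \<le> b" "b \<le> H" for f f' :: "real \<Rightarrow> real" and a b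
      using deriv_le_imp_diff_le[of a b "{0..H}" "\<lambda>_. 0" "\<lambda>_. 0" f f'] that by auto
    have cont: "continuous_on {0..H} u" "continuous_on {0..H} g"
      by (rule DERIV_continuous_on[OF u], assumption, rule DERIV_continuous_on[OF g])
    \<comment> \<open>\<open>(g u)' = (m + s D) u\<^sup>2 + g\<^sup>2 / D \<ge> 0\<close>; this makes \<open>u\<^sup>2\<close> increasing and replaces a maximum principle.\<close>
    have gu: "0 \<le> g x * u x" if "x \<in> {0..H}" for x
    proof -
      have "g 0 * u 0 \<le> g x * u x"
      proof (rule mono[where f = "\<lambda>x. g x * u x"])
        fix x assume x: "x \<in> {0..H}"
        show "((\<lambda>x. g x * u x) has_real_derivative (m x + s * D x) * (u x)\<^sup>2 + (g x)\<^sup>2 / D x)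
            (at x within {0..H})"
          by (rule DERIV_cong[OF DERIV_mult[OF g[OF x] u[OF x]]]) (simp add: power2_eq_square algebra_simps)
        show "0 \<le> (m x + s * D x) * (u x)\<^sup>2 + (g x)\<^sup>2 / D x"
          using q(1)[OF x] Dpos[OF x] by auto
      qed (use that in auto)
      then show ?thesis using bc by simp
    qed
    have u2_mono: "(u a)\<^sup>2 \<le> (u b)\<^sup>2" if "0 \<le> a" "a \<le> b" "b \<le> H" for a b
    proof (rule mono[where f = "\<lambda>x. (u x)\<^sup>2" and f' = "\<lambda>x. 2 * (g x * u x) / D x", OF _ _ that])
      fix x assume x: "x \<in> {0..H}"
      show "((\<lambda>x. (u x)\<^sup>2) has_real_derivative 2 * (g x * u x) / D x) (at x within {0..H})"
        by (auto intro!: derivative_eq_intros u[OF x])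
      show "0 \<le> 2 * (g x * u x) / D x" using gu[OF x] Dpos[OF x] by simp
    qed
    have u_nonneg: "0 \<le> u x" if "x \<in> {0..H}" for x
    proof (rule ccontr)
      assume "\<not> 0 \<le> u x"
      \<comment> \<open>A negative value followed by \<open>u H = 1\<close> forces a later zero,
        which contradicts the monotonicity of the square.\<close>
      then have "\<exists>z. x \<le> z \<and> z \<le> H \<and> u z = 0"
        using that bc cont(1) by (intro IVT') (auto intro: continuous_on_subset)
      then obtain z where "x \<le> z" "z \<le> H" "u z = 0" by auto
      with u2_mono[of x z] that \<open>\<not> 0 \<le> u x\<close> show False by auto
    qed
    have g_mono: "g a \<le> g b" if "0 \<le> a" "a \<le> b" "b \<le> H" for a b
      by (rule mono[OF g _ that]) (use q u_nonneg in auto)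
    have u_mvt: "\<exists>z\<in>{0<..<x}. u x = x * g z / D z" if "0 < x" "x \<le> H" for x
    proof -
      have "(u has_derivative (*) (g z / D z)) (at z within {0..x})" if "0 \<le> z" "z \<le> x" for z
        using DERIV_subset[OF u, of z "{0..x}"] that \<open>x \<le> H\<close> by (auto simp: has_field_derivative_def)
      from mvt_simple[OF that(1) this] show ?thesis using bc by (auto simp: field_simps)
    qed
    have g_pos': "0 \<le> g x" if x: "0 < x" "x \<le> H" for x
    proof (rule ccontr)
      assume "\<not> 0 \<le> g x"
      \<comment> \<open>A negative flux at \<open>x\<close> is negative at all earlier points, so
        the mean value formula would make \<open>u x\<close> negative.\<close>
      obtain z where z: "z \<in> {0<..<x}" "u x = x * g z / D z" using u_mvt[OF x] by auto
      have "g z < 0" using g_mono[of z x] z x \<open>\<not> 0 \<le> g x\<close> by auto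
      then have "x * g z / D z < 0" using x z Dpos[of z] by (auto simp: divide_less_0_iff mult_less_0_iff)
      with u_nonneg[of x] x z show False by auto
    qed
    have g_nonneg: "0 \<le> g x" if "x \<in> {0..H}" for x
    proof (cases "x = 0")
      case True
      show ?thesis
      proof (rule ccontr)
        assume "\<not> 0 \<le> g x"
        \<comment> \<open>By continuity \<open>g\<close> takes the negative value
          \<open>g 0 / 2\<close> somewhere; that point differs from \<open>0\<close>, and there the
          sign is already known.\<close>
        then have "\<exists>z\<ge>0. z \<le> H \<and> g z = g 0 / 2"
          using g_pos'[of H] assms cont(2) True by (intro IVT') auto
        then obtain z where "0 \<le> z" "z \<le> H" "g z = g 0 / 2" by auto
        then show False using g_pos'[of z] \<open>\<not> 0 \<le> g x\<close> True by (cases "z = 0") auto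
      qed
    qed (use g_pos' that in auto)
    have u_le_1: "u x \<le> 1" if "x \<in> {0..H}" for x
      using mono[OF u, of x H] that bc g_nonneg Dpos by (auto simp: less_imp_le)
    have g_le: "g x \<le> G" if x: "x \<in> {0..H}" for x
    proof -
      obtain z where z: "z \<in> {0<..<H}" "1 = H * g z / D z" using u_mvt[of H] assms bc by auto
      then have gz: "g z \<le> M / H" using D[of z] Dpos[of z] assms by (auto simp: field_simps)
      show ?thesis
      proof (cases "x \<le> z")
        case True
        then have "g x \<le> g z" using g_mono x z by auto
        also have "\<dots> \<le> G" using gz B assms by (auto simp: G_def intro!: add_increasing2)
        finally show ?thesis .
      next
        case False
        have "g x - g z \<le> B * x - B * z"
        proof (rule deriv_le_imp_diff_le[OF _ _ g, where g' = "\<lambda>_. B"])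
          fix t assume "t \<in> {z..x}"
          then have t: "t \<in> {0..H}" using x z by auto
          show "(m t + s * D t) * u t \<le> B"
            using mult_mono[OF q(2)[OF t] u_le_1[OF t] B u_nonneg[OF t]] by simp
          show "((*) B has_real_derivative B) (at t within {0..H})"
            by (auto intro!: derivative_eq_intros)
        qed (use False x z in auto)
        also have "\<dots> \<le> B * H" using x z B by (auto simp: right_diff_distrib[symmetric] intro!: mult_left_mono)
        finally show ?thesis using gz by (simp add: G_def)
      qed
    qed
    \<comment> \<open>\<open>(g + u)' \<le> K (g + u)\<close>, and \<open>g + u \<ge> 1\<close> at \<open>H\<close> while \<open>u\<close> vanishes at \<open>0\<close>.\<close>
    have g0: "exp (- K * H) \<le> g 0"
    proof -
      have "(- ((g H + u H) * exp (- K * H))) - (- ((g 0 + u 0) * exp (- K * 0))) \<ge> 0 - (0::real)"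
      proof (rule deriv_le_imp_diff_le[where S = "{0..H}" and f = "\<lambda>_. 0" and f' = "\<lambda>_. 0"
            and g = "\<lambda>x. - ((g x + u x) * exp (- K * x))"])
        fix x assume x: "x \<in> {0..H}"
        show "((\<lambda>x. - ((g x + u x) * exp (- K * x))) has_real_derivative
            (K * (g x + u x) - ((m x + s * D x) * u x + g x / D x)) * exp (- K * x)) (at x within {0..H})"
          by (auto intro!: derivative_eq_intros u[OF x] g[OF x] simp: algebra_simps)
        have "(m x + s * D x) * u x \<le> B * u x" using q[OF x] u_nonneg[OF x] by (intro mult_right_mono)
        also have "\<dots> \<le> K * u x"
          using u_nonneg[OF x] assms by (intro mult_right_mono) (auto simp: K_def)
        finally have 1: "(m x + s * D x) * u x \<le> K * u x" .
        have "g x / D x \<le> g x / D\<^sub>0" using g_nonneg[OF x] D[OF x] assms by (intro divide_left_mono) auto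
        also have "\<dots> \<le> K * g x" using g_nonneg[OF x] B by (simp add: K_def field_simps)
        finally show "0 \<le> (K * (g x + u x) - ((m x + s * D x) * u x + g x / D x)) * exp (- K * x)"
          using 1 by (intro mult_nonneg_nonneg) (auto simp: algebra_simps)
      qed (use assms in auto)
      then have "(g H + 1) * exp (- K * H) \<le> g 0" using bc by simp
      moreover have "1 * exp (- K * H) \<le> (g H + 1) * exp (- K * H)"
        using g_nonneg[of H] assms by (intro mult_right_mono) auto
      ultimately show ?thesis by linarith
    qed
    have "u y \<le> G / D\<^sub>0 * y"
    proof -
      have "u y - u 0 \<le> G / D\<^sub>0 * y - G / D\<^sub>0 * 0"
      proof (rule deriv_le_imp_diff_le[OF _ _ u, where g' = "\<lambda>_. G / D\<^sub>0"])
        fix x assume "x \<in> {0..y}"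
        then have x: "x \<in> {0..H}" using y by auto
        show "g x / D x \<le> G / D\<^sub>0" using g_le[OF x] D[OF x] assms G by (intro frac_le) auto
      next
        fix x assume "x \<in> {0..y}"
        show "((*) (G / D\<^sub>0) has_real_derivative G / D\<^sub>0) (at x within {0..H})"
          by (auto intro!: derivative_eq_intros)
      qed (use y in auto)
      then show ?thesis using bc by simp
    qed
    also have "\<dots> \<le> C * y" using y G assms by (intro mult_right_mono) (auto simp: C_def)
    finally have 1: "u y \<le> C * y" .
    have "exp (- K * H) / M * y - exp (- K * H) / M * 0 \<le> u y - u 0"
    proof (rule deriv_le_imp_diff_le[OF _ _ _ u, where f' = "\<lambda>_. exp (- K * H) / M"])
      fix x assume "x \<in> {0..y}"
      then have x: "x \<in> {0..H}" using y by auto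
      show "exp (- K * H) / M \<le> g x / D x"
        using g0 g_mono[of 0 x] g_nonneg[OF x] D[OF x] Dpos[OF x] assms x by (intro frac_le) auto
    next
      fix x assume "x \<in> {0..y}"
      show "((*) (exp (- K * H) / M) has_real_derivative exp (- K * H) / M) (at x within {0..H})"
        by (auto intro!: derivative_eq_intros)
    qed (use y in auto)
    then have "y \<le> M * exp (K * H) * u y" using bc assms by (simp add: field_simps exp_minus)
    also have "\<dots> \<le> C * u y" using u_nonneg[OF y] G assms by (intro mult_right_mono) (auto simp: C_def)
    finally have 2: "y \<le> C * u y" .
    have "G \<le> C" using G assms by (auto simp: C_def)
    then have "\<bar>g y\<bar> \<le> C" using g_le[OF y] g_nonneg[OF y] by simp
    with 1 2 show "y \<le> C * u y \<and> u y \<le> C * y \<and> \<bar>g y\<bar> \<le> C" by simp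
  qed
qed

section \<open>A Gronwall estimate for a singular system\<close>

text \<open>The exponents are those of \<open>p = 1 / u\<close>: integrating \<open>\<beta> / t\<^sup>4\<close> costs one power, so \<open>y\<^sup>3 P\<close> and \<open>y R\<close>
  stay bounded. An exponentially weighted supremum \<open>T\<close> of both then satisfies \<open>T \<le> T / 2 + const\<close>.\<close>

lemma singular_gronwall:
  fixes P R P' R' :: "real \<Rightarrow> real"
  assumes "0 < H" "0 < \<alpha>" "0 \<le> \<beta>"
    and P: "\<And>t. t \<in> {0<..H} \<Longrightarrow> (P has_real_derivative P' t) (at t within {0<..H})"
    and R: "\<And>t. t \<in> {0<..H} \<Longrightarrow> (R has_real_derivative R' t) (at t within {0<..H})"
    and P': "\<And>t. t \<in> {0<..H} \<Longrightarrow> \<bar>P' t\<bar> \<le> \<alpha> * \<bar>R t\<bar> / t^2 + \<beta> / t^4"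
    and R': "\<And>t. t \<in> {0<..H} \<Longrightarrow> \<bar>R' t\<bar> \<le> \<alpha> * t^2 * \<bar>P t\<bar> + \<beta> / t"
    and H: "P H = 0" "\<bar>R H\<bar> \<le> \<beta>"
    and bdd: "\<And>t. t \<in> {0<..H} \<Longrightarrow> t^3 * \<bar>P t\<bar> \<le> b" "\<And>t. t \<in> {0<..H} \<Longrightarrow> t * \<bar>R t\<bar> \<le> b"
    and y: "y \<in> {0<..H}"
  shows "y^3 * \<bar>P y\<bar> \<le> 2 * \<beta> * (1 + 2 * H) * exp (2 * \<alpha> * H)"
proof -
  \<comment> \<open>With this rate \<open>\<alpha> / \<omega>\<close> is \<open>1 / 2\<close>, so
    the term containing \<open>T\<close> can be absorbed at the end.\<close>
  define \<omega> where "\<omega> = 2 * \<alpha>"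
  define N where "N = (\<lambda>t. exp (- \<omega> * (H - t)) * max (t^3 * \<bar>P t\<bar>) (t * \<bar>R t\<bar>))"
  define T where "T = (SUP t\<in>{0<..H}. N t)"
  have \<omega>: "0 < \<omega>" using assms by (simp add: \<omega>_def)
  \<comment> \<open>The a priori bound \<open>b\<close> makes the supremum \<open>T\<close> finite,
    without which nothing could be absorbed.\<close>
  have "N t \<le> b" if t: "t \<in> {0<..H}" for t
  proof -
    have "N t \<le> 1 * b" unfolding N_def
      using t \<omega> bdd[OF t] by (intro mult_mono) (auto simp: le_max_iff_disj)
    then show ?thesis by simp
  qed
  then have "bdd_above (N ` {0<..H})" by (intro bdd_aboveI2)
  then have N_le: "N t \<le> T" if "t \<in> {0<..H}" for t
    unfolding T_def using that by (intro cSUP_upper)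
  have "0 \<le> N H" using assms by (auto simp: N_def le_max_iff_disj)
  then have T0: "0 \<le> T" using N_le[of H] assms by auto
  have max_le: "max (t^3 * \<bar>P t\<bar>) (t * \<bar>R t\<bar>) \<le> T * exp (\<omega> * (H - t))" if "t \<in> {0<..H}" for t
  proof -
    have "exp (- \<omega> * (H - t)) * exp (\<omega> * (H - t)) = 1" by (simp flip: exp_add)
    then have "max (t^3 * \<bar>P t\<bar>) (t * \<bar>R t\<bar>) = N t * exp (\<omega> * (H - t))"
      by (simp add: N_def mult.assoc mult.left_commute)
    then show ?thesis using N_le[OF that] by (simp add: mult_right_mono)
  qed
  have step: "N t \<le> \<alpha> * T / \<omega> + \<beta> * (1 + 2 * H)" if t: "t \<in> {0<..H}" for t
  proof -
    let ?E = "exp (\<omega> * (H - t))"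
    have t0: "0 < t" "t \<le> H" using t by auto
    have sub: "{t..H} \<subseteq> {0<..H}" using t0 by auto
    \<comment> \<open>The factor \<open>1 / x^3\<close> is frozen at its larger value
      \<open>1 / t^3\<close>, which gives the majorant of \<open>P'\<close> an explicit primitive.
      Integrating the exponential gains \<open>1 / \<omega>\<close>.\<close>
    have "\<bar>P H - P t\<bar> \<le> (- (\<alpha> * T / t^3 * exp (\<omega> * (H - H)) / \<omega>) - \<beta> / (3 * H^3))
        - (- (\<alpha> * T / t^3 * ?E / \<omega>) - \<beta> / (3 * t^3))"
    proof (rule abs_deriv_le_imp_abs_diff_le[OF t0(2) sub P])
      fix x assume x: "x \<in> {t..H}"
      then have x0: "0 < x" "x \<in> {0<..H}" using t0 by auto
      show "((\<lambda>x. - (\<alpha> * T / t^3 * exp (\<omega> * (H - x)) / \<omega>) - \<beta> / (3 * x^3)) has_real_derivative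
          \<alpha> * T / t^3 * exp (\<omega> * (H - x)) + \<beta> / x^4) (at x within {0<..H})"
        using x0 \<omega> t0 by (auto intro!: derivative_eq_intros simp: field_simps power_numeral_reduce)
      have "\<bar>R x\<bar> \<le> T * exp (\<omega> * (H - x)) / x" using max_le[OF x0(2)] x0 by (simp add: field_simps)
      then have "\<alpha> * \<bar>R x\<bar> / x^2 \<le> \<alpha> * (T * exp (\<omega> * (H - x)) / x) / x^2"
        using assms by (intro divide_right_mono mult_left_mono) auto
      also have "\<dots> = \<alpha> * T * exp (\<omega> * (H - x)) / x^3"
        by (simp add: power_numeral_reduce)
      also have "\<dots> \<le> \<alpha> * T * exp (\<omega> * (H - x)) / t^3"
        using x t0 T0 assms by (intro divide_left_mono mult_pos_pos power_mono) auto
      finally show "\<bar>P' x\<bar> \<le> \<alpha> * T / t^3 * exp (\<omega> * (H - x)) + \<beta> / x^4"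
        using P'[OF x0(2)] by simp
    qed (use sub in auto)
    also have "\<dots> \<le> \<alpha> * T / t^3 * ?E / \<omega> + \<beta> / (3 * t^3)"
    proof -
      have "0 \<le> \<alpha> * T / t^3 * exp (\<omega> * (H - H)) / \<omega>" "0 \<le> \<beta> / (3 * H^3)"
        using assms(1-3) t0 T0 \<omega> by simp_all
      then show ?thesis by linarith
    qed
    finally have "t^3 * \<bar>P t\<bar> \<le> t^3 * (\<alpha> * T / t^3 * ?E / \<omega> + \<beta> / (3 * t^3))"
      using H t0 by (intro mult_left_mono) auto
    also have "\<dots> = ?E * (\<alpha> * T / \<omega>) + \<beta> / 3" using t0 \<omega> by (simp add: field_simps)
    also have "\<dots> \<le> ?E * (\<alpha> * T / \<omega>) + \<beta> * (1 + 2 * H)"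
      using assms by (simp add: field_simps)
    finally have A: "t^3 * \<bar>P t\<bar> \<le> ?E * (\<alpha> * T / \<omega>) + \<beta> * (1 + 2 * H)" .
    \<comment> \<open>The same scheme with \<open>1 / x\<close> frozen at \<open>1 / t\<close>; the
      value at \<open>H\<close> adds a further \<open>\<beta>\<close>.\<close>
    have "\<bar>R H - R t\<bar> \<le> (- (\<alpha> * T / t * exp (\<omega> * (H - H)) / \<omega>) + \<beta> / t * H)
        - (- (\<alpha> * T / t * ?E / \<omega>) + \<beta> / t * t)"
    proof (rule abs_deriv_le_imp_abs_diff_le[OF t0(2) sub R])
      fix x assume x: "x \<in> {t..H}"
      then have x0: "0 < x" "x \<in> {0<..H}" using t0 by auto
      show "((\<lambda>x. - (\<alpha> * T / t * exp (\<omega> * (H - x)) / \<omega>) + \<beta> / t * x) has_real_derivative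
          \<alpha> * T / t * exp (\<omega> * (H - x)) + \<beta> / t) (at x within {0<..H})"
        using x0 \<omega> t0 by (auto intro!: derivative_eq_intros simp: field_simps)
      have "x^2 * \<bar>P x\<bar> \<le> T * exp (\<omega> * (H - x)) / x"
        using max_le[OF x0(2)] x0 by (simp add: field_simps power_numeral_reduce)
      also have "\<dots> \<le> T * exp (\<omega> * (H - x)) / t"
        using x t0 T0 by (intro divide_left_mono) auto
      finally have "\<alpha> * (x^2 * \<bar>P x\<bar>) \<le> \<alpha> * (T * exp (\<omega> * (H - x)) / t)"
        using assms by (intro mult_left_mono) auto
      moreover have "\<beta> / x \<le> \<beta> / t" using x t0 assms by (intro divide_left_mono) auto
      ultimately show "\<bar>R' x\<bar> \<le> \<alpha> * T / t * exp (\<omega> * (H - x)) + \<beta> / t"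
        using R'[OF x0(2)] by (simp add: mult.assoc)
    qed (use sub in auto)
    also have "\<dots> \<le> \<alpha> * T / t * ?E / \<omega> + \<beta> / t * H"
    proof -
      have "0 \<le> \<alpha> * T / t * exp (\<omega> * (H - H)) / \<omega>" "0 \<le> \<beta> / t * t"
        using assms(1-3) t0 T0 \<omega> by simp_all
      then show ?thesis by linarith
    qed
    finally have "\<bar>R t\<bar> \<le> \<beta> + (\<alpha> * T / t * ?E / \<omega> + \<beta> / t * H)" using H by linarith
    then have "t * \<bar>R t\<bar> \<le> t * (\<beta> + (\<alpha> * T / t * ?E / \<omega> + \<beta> / t * H))"
      using t0 by (intro mult_left_mono) auto
    also have "\<dots> = ?E * (\<alpha> * T / \<omega>) + \<beta> * (t + H)" using t0 \<omega> by (simp add: field_simps)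
    also have "\<dots> \<le> ?E * (\<alpha> * T / \<omega>) + \<beta> * (1 + 2 * H)"
      using assms t0 by (intro add_left_mono mult_left_mono) auto
    finally have B: "t * \<bar>R t\<bar> \<le> ?E * (\<alpha> * T / \<omega>) + \<beta> * (1 + 2 * H)" .
    have "N t \<le> exp (- \<omega> * (H - t)) * (?E * (\<alpha> * T / \<omega>) + \<beta> * (1 + 2 * H))"
      unfolding N_def using A B by (intro mult_left_mono) auto
    also have "\<dots> = \<alpha> * T / \<omega> + exp (- \<omega> * (H - t)) * (\<beta> * (1 + 2 * H))"
      by (simp add: distrib_left exp_minus)
    also have "\<dots> \<le> \<alpha> * T / \<omega> + 1 * (\<beta> * (1 + 2 * H))"
      using assms \<omega> t0 by (intro add_left_mono mult_right_mono) auto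
    finally show ?thesis by simp
  qed
  have "T \<le> \<alpha> * T / \<omega> + \<beta> * (1 + 2 * H)"
    unfolding T_def using step[unfolded T_def] assms by (intro cSUP_least) auto
  then have T: "T \<le> 2 * \<beta> * (1 + 2 * H)" using assms by (simp add: \<omega>_def)
  have "y^3 * \<bar>P y\<bar> \<le> T * exp (\<omega> * (H - y))" using max_le[OF y] by simp
  also have "\<dots> \<le> 2 * \<beta> * (1 + 2 * H) * exp (2 * \<alpha> * H)"
    using T T0 y assms by (intro mult_mono) (auto simp: \<omega>_def)
  finally show ?thesis .
qed

section \<open>Stability of the coefficients\<close>

text \<open>A single constant \<open>C\<close> bounds everything from above and, through \<open>1 / C\<close>, from below; \<open>s1\<close> and \<open>s2\<close> are the
  squared frequencies.\<close>

locale flux_system =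
  fixes H C s1 s2 :: real and D m dm u1 u2 g1 g2 :: "real \<Rightarrow> real"
  assumes C: "1 \<le> C" and H: "0 < H" "H \<le> C" "1 / C \<le> H"
    and s: "0 \<le> s1" "s1 \<le> C" "1 / C \<le> s2 - s1" "s2 - s1 \<le> C"
    and D: "\<And>y. y \<in> {0..H} \<Longrightarrow> 1 / C \<le> D y" "\<And>y. y \<in> {0..H} \<Longrightarrow> D y \<le> C"
    and m: "\<And>y. y \<in> {0..H} \<Longrightarrow> 1 / C \<le> m y" "\<And>y. y \<in> {0..H} \<Longrightarrow> m y \<le> C"
    and dm: "\<And>y. y \<in> {0..H} \<Longrightarrow> \<bar>dm y\<bar> \<le> C"
    and u1: "\<And>y. y \<in> {0..H} \<Longrightarrow> y / C \<le> u1 y" "\<And>y. y \<in> {0..H} \<Longrightarrow> u1 y \<le> C * y"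
    and u2: "\<And>y. y \<in> {0..H} \<Longrightarrow> y / C \<le> u2 y" "\<And>y. y \<in> {0..H} \<Longrightarrow> u2 y \<le> C * y"
    and g1: "\<And>y. y \<in> {0..H} \<Longrightarrow> \<bar>g1 y\<bar> \<le> C"
    and g2: "\<And>y. y \<in> {0..H} \<Longrightarrow> \<bar>g2 y\<bar> \<le> C"
    and deriv_u1: "\<And>y. y \<in> {0..H} \<Longrightarrow> (u1 has_real_derivative g1 y / D y) (at y within {0..H})"
    and deriv_u2: "\<And>y. y \<in> {0..H} \<Longrightarrow> (u2 has_real_derivative g2 y / D y) (at y within {0..H})"
    and deriv_g1: "\<And>y. y \<in> {0..H} \<Longrightarrow> (g1 has_real_derivative (m y + s1 * D y) * u1 y) (at y within {0..H})"
    and deriv_g2: "\<And>y. y \<in> {0..H} \<Longrightarrow> (g2 has_real_derivative (m y + s2 * D y) * u2 y) (at y within {0..H})"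
    and deriv_m: "\<And>y. y \<in> {0..H} \<Longrightarrow> (m has_real_derivative dm y) (at y within {0..H})"
    and cont_D: "continuous_on {0..H} D" and cont_dm: "continuous_on {0..H} dm"
    and u_H: "u1 H = 1" "u2 H = 1"
begin

text \<open>\<open>W\<close> is the Wronskian of the two solutions weighted by \<open>D\<close>, \<open>J\<close> the Wronskian of the data \<open>h1\<close>,
  \<open>h2\<close>; \<open>dh1\<close>, \<open>dh2\<close> are the derivatives of the data.\<close>

definition "W y = u1 y * g2 y - u2 y * g1 y"
definition "h1 y = m y * u1 y"
definition "h2 y = m y * u2 y"
definition "dh1 y = dm y * u1 y + m y * (g1 y / D y)"
definition "dh2 y = dm y * u2 y + m y * (g2 y / D y)"
definition "J y = h1 y * dh2 y - dh1 y * h2 y"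
definition "a y = D y * (u1 y)\<^sup>2"

section \<open>Bounds and identities for a single coefficient pair\<close>

lemma C_pos: "0 < C" using C by simp

lemma s_less: "s1 < s2"
  using s(3) C_pos by (smt (verit) zero_less_divide_1_iff)

lemma D_pos: "y \<in> {0..H} \<Longrightarrow> 0 < D y"
  using D(1) C_pos by (meson less_le_trans zero_less_divide_1_iff)

lemma m_pos: "y \<in> {0..H} \<Longrightarrow> 0 < m y"
  using m(1) C_pos by (meson less_le_trans zero_less_divide_1_iff)

lemma inv_D: "y \<in> {0..H} \<Longrightarrow> 1 / C \<le> 1 / D y" "y \<in> {0..H} \<Longrightarrow> 1 / D y \<le> C"
  using D D_pos C_pos by (auto simp: field_simps)

lemma u_nonneg: "y \<in> {0..H} \<Longrightarrow> 0 \<le> u1 y" "y \<in> {0..H} \<Longrightarrow> 0 \<le> u2 y"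
  using u1(1) u2(1) C_pos by (meson atLeastAtMost_iff divide_nonneg_pos order_trans)+

lemma u_0: "u1 0 = 0" "u2 0 = 0"
  using u1[of 0] u2[of 0] H by simp_all

lemma u1_pos: "y \<in> {0<..H} \<Longrightarrow> 0 < u1 y"
  using u1(1)[of y] C_pos by (smt (verit) atLeastAtMost_iff divide_pos_pos greaterThanAtMost_iff)

text \<open>The products of the two fluxes and the terms with \<open>m\<close> cancel; only the gap
  between the squared frequencies survives.\<close>

lemma deriv_W:
  assumes y: "y \<in> {0..H}"
  shows "(W has_real_derivative (s2 - s1) * D y * (u1 y * u2 y)) (at y within {0..H})"
  unfolding W_def
  by (rule DERIV_cong[OF DERIV_diff[OF DERIV_mult[OF deriv_u1[OF y] deriv_g2[OF y]]
      DERIV_mult[OF deriv_u2[OF y] deriv_g1[OF y]]]]) (simp add: algebra_simps)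

text \<open>\<open>W\<close> vanishes at \<open>0\<close> and its derivative is comparable to
  \<open>y^2\<close>, so integration gives the order \<open>y^3\<close>.\<close>

lemma W_bounds:
  assumes y: "y \<in> {0..H}"
  shows "y^3 / (3 * C^4) \<le> W y" "W y \<le> C^4 * y^3"
proof -
  have W0: "W 0 = 0" by (simp add: W_def u_0)
  have sub: "{0..y} \<subseteq> {0..H}" "0 \<le> y" using y by auto
  have "y^3 / (3 * C^4) - 0^3 / (3 * C^4) \<le> W y - W 0"
  proof (rule deriv_le_imp_diff_le[OF sub(2,1) _ deriv_W])
    fix x assume "x \<in> {0..y}"
    then have x: "x \<in> {0..H}" using y by auto
    show "((\<lambda>y. y^3 / (3 * C^4)) has_real_derivative x^2 / C^4) (at x within {0..H})"
      using C_pos by (auto intro!: derivative_eq_intros simp: field_simps eval_nat_numeral)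
    have "x^2 / C^4 = (1 / C) * (1 / C) * ((x / C) * (x / C))"
      by (simp add: eval_nat_numeral)
    also have "\<dots> \<le> (s2 - s1) * D x * (u1 x * u2 x)"
      using s s_less D[OF x] u1[OF x] u2[OF x] u_nonneg[OF x] D_pos[OF x] C_pos x
      by (intro mult_mono mult_nonneg_nonneg) auto
    finally show "x^2 / C^4 \<le> (s2 - s1) * D x * (u1 x * u2 x)" .
  qed (use sub in auto)
  then show "y^3 / (3 * C^4) \<le> W y" using W0 by simp
  have "W y - W 0 \<le> C^4 * y^3 / 3 - C^4 * 0^3 / 3"
  proof (rule deriv_le_imp_diff_le[OF sub(2,1) deriv_W])
    fix x assume "x \<in> {0..y}"
    then have x: "x \<in> {0..H}" using y by auto
    show "((\<lambda>y. C^4 * y^3 / 3) has_real_derivative C^4 * x^2) (at x within {0..H})"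
      using C_pos by (auto intro!: derivative_eq_intros simp: field_simps eval_nat_numeral)
    have "(s2 - s1) * D x * (u1 x * u2 x) \<le> C * C * ((C * x) * (C * x))"
      using s s_less D[OF x] u1[OF x] u2[OF x] u_nonneg[OF x] D_pos[OF x] C_pos x
      by (intro mult_mono mult_nonneg_nonneg) auto
    also have "\<dots> = C^4 * x^2" by (simp add: eval_nat_numeral)
    finally show "(s2 - s1) * D x * (u1 x * u2 x) \<le> C^4 * x^2" .
  qed (use sub in auto)
  moreover have "0 \<le> C^4 * y^3" using sub C_pos by simp
  ultimately show "W y \<le> C^4 * y^3" using W0 by simp
qed

lemma W_nonneg: "y \<in> {0..H} \<Longrightarrow> 0 \<le> W y"
  using C_pos by (intro order_trans[OF _ W_bounds(1)]) auto

lemma W_pos: "y \<in> {0<..H} \<Longrightarrow> 0 < W y"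
  using W_bounds(1)[of y] C_pos
  by (smt (verit) atLeastAtMost_iff greaterThanAtMost_iff divide_pos_pos mult_pos_pos zero_less_power)

lemma h1_bounds: "y \<in> {0..H} \<Longrightarrow> 0 \<le> h1 y" "y \<in> {0..H} \<Longrightarrow> h1 y \<le> C^2 * y"
  unfolding h1_def power2_eq_square mult.assoc
  using m u1 u_nonneg m_pos[THEN less_imp_le] C_pos by (auto intro!: mult_mono mult_nonneg_nonneg)

lemma h2_bounds: "y \<in> {0..H} \<Longrightarrow> 0 \<le> h2 y" "y \<in> {0..H} \<Longrightarrow> h2 y \<le> C^2 * y"
  unfolding h2_def power2_eq_square mult.assoc
  using m u2 u_nonneg m_pos[THEN less_imp_le] C_pos by (auto intro!: mult_mono mult_nonneg_nonneg)

lemma dh_bounds: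
  assumes y: "y \<in> {0..H}"
  shows "\<bar>dh1 y\<bar> \<le> 2 * C^3" "\<bar>dh2 y\<bar> \<le> 2 * C^3"
proof -
  have *: "\<bar>dm y * u + m y * (g / D y)\<bar> \<le> 2 * C^3" if "0 \<le> u" "u \<le> C * y" "\<bar>g\<bar> \<le> C" for u g
  proof -
    have "C * y \<le> C * C" using y H C_pos by (intro mult_left_mono) auto
    then have u: "\<bar>u\<bar> \<le> C * C" using that by auto
    have "\<bar>g * (1 / D y)\<bar> \<le> C * C"
      using inv_D[OF y] D_pos[OF y] that by (intro abs_mult_le) auto
    then have "\<bar>m y * (g / D y)\<bar> \<le> C * (C * C)"
      using m[OF y] m_pos[OF y] by (intro abs_mult_le) auto
    moreover have "\<bar>dm y * u\<bar> \<le> C * (C * C)" by (rule abs_mult_le[OF dm[OF y] u])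
    moreover have "C^3 = C * (C * C)" by (simp add: eval_nat_numeral)
    ultimately show ?thesis by linarith
  qed
  show "\<bar>dh1 y\<bar> \<le> 2 * C^3" "\<bar>dh2 y\<bar> \<le> 2 * C^3"
    unfolding dh1_def dh2_def
    using *[OF u_nonneg(1)[OF y] u1(2)[OF y] g1[OF y]] *[OF u_nonneg(2)[OF y] u2(2)[OF y] g2[OF y]]
    by simp_all
qed

lemma deriv_h:
  assumes "y \<in> {0..H}"
  shows "(h1 has_real_derivative dh1 y) (at y within {0..H})"
    "(h2 has_real_derivative dh2 y) (at y within {0..H})"
  unfolding h1_def h2_def dh1_def dh2_def using assms
  by (auto intro!: derivative_eq_intros deriv_m deriv_u1 deriv_u2)

lemma continuous_on_dh: "continuous_on {0..H} dh1" "continuous_on {0..H} dh2"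
proof -
  note cont = DERIV_continuous_on[OF deriv_m] DERIV_continuous_on[OF deriv_u1] DERIV_continuous_on[OF deriv_u2]
    DERIV_continuous_on[OF deriv_g1] DERIV_continuous_on[OF deriv_g2]
  have "\<forall>y\<in>{0..H}. D y \<noteq> 0" using D_pos by force
  then show "continuous_on {0..H} dh1" "continuous_on {0..H} dh2"
    unfolding dh1_def dh2_def by (intro continuous_intros cont cont_D cont_dm; simp)+
qed

text \<open>In the Wronskian of \<open>m u1\<close> and \<open>m u2\<close> the terms with
  \<open>dm\<close> cancel. What remains is \<open>m^2\<close> times the ordinary Wronskian of the
  solutions, which is \<open>W / D\<close>.\<close>

lemma J_eq: "y \<in> {0..H} \<Longrightarrow> J y = (m y)\<^sup>2 * W y / D y"
  using D_pos[of y] by (simp add: J_def h1_def h2_def dh1_def dh2_def W_def field_simps power2_eq_square)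

lemma J_bounds:
  assumes y: "y \<in> {0..H}"
  shows "y^3 / (3 * C^7) \<le> J y" "J y \<le> C^7 * y^3"
proof -
  have J: "J y = m y * m y * W y * (1 / D y)" using J_eq[OF y] by (simp add: power2_eq_square)
  have "y^3 / (3 * C^7) = 1 / C * (1 / C) * (y^3 / (3 * C^4)) * (1 / C)"
    by (simp add: eval_nat_numeral)
  also have "\<dots> \<le> J y" unfolding J
    using m[OF y] m_pos[OF y] inv_D[OF y] W_bounds[OF y] W_nonneg[OF y] C_pos y
    by (intro mult_mono mult_nonneg_nonneg) auto
  finally show "y^3 / (3 * C^7) \<le> J y" .
  have "J y \<le> C * C * (C^4 * y^3) * C" unfolding J
    using m[OF y] m_pos[OF y] inv_D[OF y] D_pos[OF y] W_bounds[OF y] W_nonneg[OF y] C_pos y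
    by (intro mult_mono mult_nonneg_nonneg) auto
  then show "J y \<le> C^7 * y^3" by (simp add: eval_nat_numeral mult_ac)
qed

lemma J_nonneg: "y \<in> {0..H} \<Longrightarrow> 0 \<le> J y"
  using C_pos by (intro order_trans[OF _ J_bounds(1)]) auto

lemma J_pos: "y \<in> {0<..H} \<Longrightarrow> 0 < J y"
  using J_bounds(1)[of y] C_pos
  by (smt (verit) atLeastAtMost_iff greaterThanAtMost_iff divide_pos_pos mult_pos_pos zero_less_power)

lemma a_bounds:
  assumes y: "y \<in> {0..H}"
  shows "y^2 / C^3 \<le> a y" "a y \<le> C^3 * y^2"
proof -
  have "y^2 / C^3 = 1 / C * ((y / C) * (y / C))" by (simp add: eval_nat_numeral)
  also have "\<dots> \<le> a y" unfolding a_def power2_eq_square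
    using D[OF y] D_pos[OF y] u1[OF y] u_nonneg[OF y] C_pos y
    by (intro mult_mono mult_nonneg_nonneg) auto
  finally show "y^2 / C^3 \<le> a y" .
  have "a y \<le> C * ((C * y) * (C * y))" unfolding a_def power2_eq_square
    using D[OF y] D_pos[OF y] u1[OF y] u_nonneg[OF y] C_pos y
    by (intro mult_mono mult_nonneg_nonneg) auto
  then show "a y \<le> C^3 * y^2" by (simp add: eval_nat_numeral mult_ac)
qed

lemma a_pos: "y \<in> {0<..H} \<Longrightarrow> 0 < a y"
  unfolding a_def using D_pos[of y] u1_pos[of y] by simp

text \<open>\<open>J_eq\<close> gives \<open>D = m^2 W / J\<close>, and \<open>m u1\<close> is the
  datum. The point \<open>0\<close> is excluded because \<open>J\<close> vanishes there.\<close>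

lemma a_eq:
  assumes "y \<in> {0<..H}"
  shows "a y = W y * (h1 y * h1 y) / J y"
proof -
  have "a y * J y = W y * (h1 y * h1 y)"
    using J_eq[of y] D_pos[of y] assms by (simp add: a_def h1_def power2_eq_square)
  then show ?thesis using J_pos[OF assms] by (simp add: nonzero_eq_divide_eq)
qed

end

section \<open>Comparison of two coefficient pairs\<close>

text \<open>The factor 252 is 180 + 72, the two contributions in \<open>a_diff\<close>.\<close>

definition a_const :: "real \<Rightarrow> real" where
  "a_const C = 252 * C^41"

text \<open>The bound of \<open>singular_gronwall\<close> for \<open>\<alpha> = C^4\<close> and
  \<open>\<beta> = 2 * C^7 * a_const C * e\<close>, with \<open>e\<close> divided out.\<close>

definition recip_const :: "real \<Rightarrow> real \<Rightarrow> real" where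
  "recip_const C H = 4 * C^7 * a_const C * (1 + 2 * H) * exp (2 * C^4 * H)"

text \<open>\<open>e\<close> plays the role of the C^1 distance of the data. The data vanish at
  \<open>0\<close>, hence the extra factor \<open>y\<close> in their undifferentiated
  differences.\<close>

locale flux_pair =
  X: flux_system H C s1 s2 D m dm u1 u2 g1 g2 +
  Y: flux_system H C s1 s2 D' m' dm' u1' u2' g1' g2'
  for H C s1 s2 :: real and D m dm u1 u2 g1 g2 D' m' dm' u1' u2' g1' g2' +
  fixes e :: real
  assumes e: "0 \<le> e"
    and h1_diff: "\<And>y. y \<in> {0..H} \<Longrightarrow> \<bar>X.h1 y - Y.h1 y\<bar> \<le> e * y"
    and h2_diff: "\<And>y. y \<in> {0..H} \<Longrightarrow> \<bar>X.h2 y - Y.h2 y\<bar> \<le> e * y"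
    and dh1_diff: "\<And>y. y \<in> {0..H} \<Longrightarrow> \<bar>X.dh1 y - Y.dh1 y\<bar> \<le> e"
    and dh2_diff: "\<And>y. y \<in> {0..H} \<Longrightarrow> \<bar>X.dh2 y - Y.dh2 y\<bar> \<le> e"
    and D_H: "D H = D' H" and dm_H: "dm H = dm' H"
begin

lemma C_power_mono: "i \<le> j \<Longrightarrow> C ^ i \<le> C ^ j"
  using X.C by (rule power_increasing[rotated])

text \<open>Each product pairs a datum of order \<open>y\<close> with a derivative of order one, so
  the difference is only \<open>O(e y)\<close>. Against \<open>J ~ y^3\<close> this is a relative
  error of order \<open>e / y^2\<close>.\<close>

lemma J_diff:
  assumes y: "y \<in> {0..H}"
  shows "\<bar>X.J y - Y.J y\<bar> \<le> 6 * C^3 * e * y"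
proof -
  have "X.J y - Y.J y = X.h1 y * (X.dh2 y - Y.dh2 y) + (X.h1 y - Y.h1 y) * Y.dh2 y
      - X.dh1 y * (X.h2 y - Y.h2 y) - (X.dh1 y - Y.dh1 y) * Y.h2 y"
    by (simp add: X.J_def Y.J_def algebra_simps)
  moreover have "\<bar>X.h1 y * (X.dh2 y - Y.dh2 y)\<bar> \<le> (C^2 * y) * e"
    using X.h1_bounds[OF y] dh2_diff[OF y] by (intro abs_mult_le) auto
  moreover have "\<bar>(X.h1 y - Y.h1 y) * Y.dh2 y\<bar> \<le> (e * y) * (2 * C^3)"
    using h1_diff[OF y] Y.dh_bounds[OF y] by (intro abs_mult_le) auto
  moreover have "\<bar>X.dh1 y * (X.h2 y - Y.h2 y)\<bar> \<le> (2 * C^3) * (e * y)"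
    using h2_diff[OF y] X.dh_bounds[OF y] by (intro abs_mult_le) auto
  moreover have "\<bar>(X.dh1 y - Y.dh1 y) * Y.h2 y\<bar> \<le> e * (C^2 * y)"
    using Y.h2_bounds[OF y] dh1_diff[OF y] by (intro abs_mult_le) auto
  ultimately have "\<bar>X.J y - Y.J y\<bar> \<le>
      (C^2 * y) * e + (e * y) * (2 * C^3) + (2 * C^3) * (e * y) + e * (C^2 * y)"
    by linarith
  also have "\<dots> = (2 * C^2 + 4 * C^3) * (e * y)" by (simp add: algebra_simps)
  also have "\<dots> \<le> (6 * C^3) * (e * y)"
    using C_power_mono[of 2 3] e y by (intro mult_right_mono) auto
  finally show ?thesis by (simp add: mult.assoc)
qed

text \<open>Stated for a generic \<open>k\<close> to serve twice: with \<open>k = h2\<close> in the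
  derivative of the ratio of the \<open>W\<close>, with \<open>k = h1\<close> in the difference of
  the \<open>a\<close>.\<close>

lemma cross_diff:
  assumes y: "y \<in> {0..H}"
    and k: "0 \<le> k" "k \<le> C^2 * y" "0 \<le> k'" "k' \<le> C^2 * y" "\<bar>k - k'\<bar> \<le> e * y"
  shows "\<bar>X.J y * (Y.h1 y * k') - Y.J y * (X.h1 y * k)\<bar> \<le> 8 * C^11 * e * y^3"
proof -
  have h: "\<bar>Y.h1 y * k' - X.h1 y * k\<bar> \<le> 2 * C^2 * e * y^2"
  proof -
    have "Y.h1 y * k' - X.h1 y * k = - (Y.h1 y * (k - k')) - (X.h1 y - Y.h1 y) * k"
      by (simp add: algebra_simps)
    moreover have "\<bar>Y.h1 y * (k - k')\<bar> \<le> (C^2 * y) * (e * y)"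
      using Y.h1_bounds[OF y] k by (intro abs_mult_le) auto
    moreover have "\<bar>(X.h1 y - Y.h1 y) * k\<bar> \<le> (e * y) * (C^2 * y)"
      using h1_diff[OF y] k by (intro abs_mult_le) auto
    ultimately have "\<bar>Y.h1 y * k' - X.h1 y * k\<bar> \<le> (C^2 * y) * (e * y) + (e * y) * (C^2 * y)"
      by linarith
    then show ?thesis by (simp add: power2_eq_square algebra_simps)
  qed
  have hk: "\<bar>X.h1 y * k\<bar> \<le> (C^2 * y) * (C^2 * y)"
    using X.h1_bounds[OF y] k by (intro abs_mult_le) auto
  have y3: "0 \<le> y^3" using y by auto
  have "X.J y * (Y.h1 y * k') - Y.J y * (X.h1 y * k) =
      X.J y * (Y.h1 y * k' - X.h1 y * k) + (X.h1 y * k) * (X.J y - Y.J y)"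
    by (simp add: algebra_simps)
  moreover have "\<bar>X.J y * (Y.h1 y * k' - X.h1 y * k)\<bar> \<le> (C^7 * y^3) * (2 * C^2 * e * y^2)"
    using X.J_bounds[OF y] X.J_nonneg[OF y] by (intro abs_mult_le h) auto
  moreover have "\<bar>(X.h1 y * k) * (X.J y - Y.J y)\<bar> \<le> ((C^2 * y) * (C^2 * y)) * (6 * C^3 * e * y)"
    by (intro abs_mult_le hk J_diff y)
  ultimately have "\<bar>X.J y * (Y.h1 y * k') - Y.J y * (X.h1 y * k)\<bar> \<le>
      (C^7 * y^3) * (2 * C^2 * e * y^2) + ((C^2 * y) * (C^2 * y)) * (6 * C^3 * e * y)"
    by linarith
  also have "\<dots> = (2 * C^9 * y^2 + 6 * C^7) * (e * y^3)"
    by (simp add: eval_nat_numeral algebra_simps)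
  also have "\<dots> \<le> (8 * C^11) * (e * y^3)"
  proof (rule mult_right_mono)
    have "y^2 \<le> C^2" using y X.H by (intro power_mono) auto
    then have "C^9 * y^2 \<le> C^9 * C^2" using X.C_pos by (intro mult_left_mono) auto
    then show "2 * C^9 * y^2 + 6 * C^7 \<le> 8 * C^11"
      using C_power_mono[of 7 11] by (simp flip: power_add)
  qed (use e y3 in auto)
  finally show ?thesis by (simp add: mult.assoc)
qed

text \<open>The quotient rule, with \<open>W\<close> and the solutions rewritten through the data by
  \<open>J_eq\<close>. The unknown coefficients then occur only as bounded factors in front of a
  difference of data.\<close>

lemma deriv_W_ratio:
  assumes y: "y \<in> {0<..H}"
  shows "((\<lambda>y. Y.W y / X.W y) has_real_derivative
    (s2 - s1) * (D y / (m y)\<^sup>2) * (D' y / (m' y)\<^sup>2) *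
      (X.J y * (Y.h1 y * Y.h2 y) - Y.J y * (X.h1 y * X.h2 y)) / (X.W y)\<^sup>2) (at y within {0<..H})"
proof -
  have y': "y \<in> {0..H}" using y by auto
  have W: "(X.W has_real_derivative (s2 - s1) * D y * (u1 y * u2 y)) (at y within {0<..H})"
    "(Y.W has_real_derivative (s2 - s1) * D' y * (u1' y * u2' y)) (at y within {0<..H})"
    by (rule DERIV_subset[OF X.deriv_W[OF y']] DERIV_subset[OF Y.deriv_W[OF y']]; auto)+
  have pos: "0 < m y" "0 < m' y" "0 < D y" "0 < D' y" "0 < X.W y"
    using X.m_pos Y.m_pos X.D_pos Y.D_pos X.W_pos y y' by auto
  have "((\<lambda>y. Y.W y / X.W y) has_real_derivative
      ((s2 - s1) * D' y * (u1' y * u2' y) * X.W y - Y.W y * ((s2 - s1) * D y * (u1 y * u2 y)))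
        / (X.W y * X.W y)) (at y within {0<..H})"
    using W pos by (intro DERIV_divide) auto
  moreover
  have eqs: "X.W y = D y * X.J y / (m y)\<^sup>2" "Y.W y = D' y * Y.J y / (m' y)\<^sup>2"
    "u1 y = X.h1 y / m y" "u2 y = X.h2 y / m y" "u1' y = Y.h1 y / m' y" "u2' y = Y.h2 y / m' y"
    using X.J_eq[OF y'] Y.J_eq[OF y'] pos by (simp_all add: X.h1_def X.h2_def Y.h1_def Y.h2_def)
  have "(s2 - s1) * D' y * (u1' y * u2' y) * X.W y - Y.W y * ((s2 - s1) * D y * (u1 y * u2 y)) =
    (s2 - s1) * (D y / (m y)\<^sup>2) * (D' y / (m' y)\<^sup>2) *
      (X.J y * (Y.h1 y * Y.h2 y) - Y.J y * (X.h1 y * X.h2 y))"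
    unfolding eqs using pos(1-4) by (simp add: power2_eq_square field_simps)
  ultimately show ?thesis by (simp add: power2_eq_square)
qed

text \<open>At \<open>H\<close> the solutions equal 1, so \<open>m H\<close> is itself the value of
  a datum. Together with the common value of \<open>D\<close> this makes the ratio computable from
  data.\<close>

lemma W_ratio_H: "\<bar>Y.W H / X.W H - 1\<bar> \<le> 24 * C^18 * e"
proof -
  have HH: "H \<in> {0..H}" "H \<in> {0<..H}" using X.H by auto
  have pos: "0 < m H" "0 < m' H" "0 < D H" "0 < D' H" "0 < X.J H" "0 < X.W H"
    using X.m_pos Y.m_pos X.D_pos Y.D_pos X.J_pos X.W_pos HH by auto
  have "X.W H = D H * X.J H / (m H)\<^sup>2" "Y.W H = D H * Y.J H / (m' H)\<^sup>2"
    using X.J_eq[OF HH(1)] Y.J_eq[OF HH(1)] pos D_H by simp_all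
  then have "Y.W H / X.W H = Y.J H * (m H * m H) / (X.J H * (m' H * m' H))"
    using pos(3) by (simp add: power2_eq_square)
  then have eq: "Y.W H / X.W H - 1 = (m H * m H * (Y.J H - X.J H) + X.J H * ((m H + m' H) * (m H - m' H)))
      / (X.J H * (m' H * m' H))"
    using pos by (simp add: field_simps)
  have num: "\<bar>m H * m H * (Y.J H - X.J H) + X.J H * ((m H + m' H) * (m H - m' H))\<bar> \<le> 8 * C^9 * e * H^3"
  proof -
    \<comment> \<open>Used to trade the factor \<open>H\<close> for \<open>H^3\<close>, matching the
      order of the denominator.\<close>
    have "1 \<le> C * H" using X.H X.C_pos by (simp add: field_simps)
    then have CH: "1 \<le> (C * H)^2" by (rule one_le_power)
    have "\<bar>m H * m H * (Y.J H - X.J H)\<bar> \<le> (C * C) * (6 * C^3 * e * H)"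
      using X.m[OF HH(1)] pos J_diff[OF HH(1)]
      by (intro abs_mult_le) (auto simp: abs_minus_commute)
    also have "\<dots> = 6 * C^5 * e * H * 1" by (simp add: eval_nat_numeral mult_ac)
    also have "\<dots> \<le> 6 * C^5 * e * H * (C * H)^2"
      using CH X.C_pos e X.H by (intro mult_left_mono) auto
    also have "\<dots> = 6 * C^7 * (e * H^3)" by (simp add: eval_nat_numeral mult_ac)
    also have "\<dots> \<le> 6 * C^9 * (e * H^3)"
      using C_power_mono[of 7 9] e X.H by (intro mult_right_mono) auto
    finally have 1: "\<bar>m H * m H * (Y.J H - X.J H)\<bar> \<le> 6 * C^9 * (e * H^3)" .
    have "\<bar>m H - m' H\<bar> \<le> e * C"
      using h1_diff[OF HH(1)] X.u_H Y.u_H mult_left_mono[OF X.H(2) e]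
      by (simp add: X.h1_def Y.h1_def)
    then have "\<bar>X.J H * ((m H + m' H) * (m H - m' H))\<bar> \<le> (C^7 * H^3) * ((C + C) * (e * C))"
      using X.J_bounds[OF HH(1)] pos X.m[OF HH(1)] Y.m[OF HH(1)] by (intro abs_mult_le) auto
    also have "\<dots> = 2 * C^9 * (e * H^3)" by (simp add: eval_nat_numeral algebra_simps)
    finally show ?thesis using 1 by simp
  qed
  have "H^3 / (3 * C^9) = H^3 / (3 * C^7) * (1 / C * (1 / C))" by (simp add: eval_nat_numeral)
  also have "\<dots> \<le> X.J H * (m' H * m' H)"
    using X.J_bounds[OF HH(1)] Y.m[OF HH(1)] pos X.C_pos by (intro mult_mono) auto
  finally have "H^3 / (3 * C^9) \<le> X.J H * (m' H * m' H)" .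
  then have "\<bar>Y.W H / X.W H - 1\<bar> \<le> (8 * C^9 * e * H^3) / (H^3 / (3 * C^9))"
    unfolding eq using num X.C_pos X.H by (intro abs_divide_le) auto
  also have "\<dots> = 24 * C^18 * e" using X.C_pos X.H by (simp add: field_simps flip: power_add)
  finally show ?thesis .
qed

text \<open>Integrating the derivative bound \<open>72 * C^26 * e / x^3\<close> from
  \<open>y\<close> to \<open>H\<close> contributes 36; the error at \<open>H\<close> contributes 24,
  after \<open>y \<le> C\<close> is used to bring it to the form \<open>e / y^2\<close>.\<close>

lemma W_ratio:
  assumes y: "y \<in> {0<..H}"
  shows "\<bar>Y.W y / X.W y - 1\<bar> \<le> 60 * C^26 * e / y^2"
proof -
  have yH: "0 < y" "y \<le> H" and sub: "{y..H} \<subseteq> {0<..H}" using y by auto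
  have "\<bar>Y.W H / X.W H - Y.W y / X.W y\<bar> \<le> - (36 * C^26 * e / H^2) - (- (36 * C^26 * e / y^2))"
  proof (rule abs_deriv_le_imp_abs_diff_le[OF yH(2) sub deriv_W_ratio])
    fix x assume "x \<in> {y..H}"
    then have x: "x \<in> {0<..H}" "x \<in> {0..H}" and x0: "0 < x" using yH by auto
    show "((\<lambda>y. - (36 * C^26 * e / y^2)) has_real_derivative 72 * C^26 * e / x^3) (at x within {0<..H})"
      using x0 by (auto intro!: derivative_eq_intros simp: field_simps eval_nat_numeral)
    have pos: "0 < m x" "0 < m' x" "0 < D x" "0 < D' x"
      using X.m_pos Y.m_pos X.D_pos Y.D_pos x by auto
    have DM: "\<bar>d / \<mu>\<^sup>2\<bar> \<le> C^3" if "0 < d" "d \<le> C" "1 / C \<le> \<mu>" for d \<mu>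
    proof -
      have "\<bar>d / \<mu>\<^sup>2\<bar> \<le> C / (1 / C)\<^sup>2"
        using that X.C_pos by (intro abs_divide_le power_mono) auto
      then show ?thesis by (simp add: eval_nat_numeral)
    qed
    have "\<bar>(s2 - s1) * (D x / (m x)\<^sup>2) * (D' x / (m' x)\<^sup>2) *
        (X.J x * (Y.h1 x * Y.h2 x) - Y.J x * (X.h1 x * X.h2 x)) / (X.W x)\<^sup>2\<bar>
        \<le> C * C^3 * C^3 * (8 * C^11 * e * x^3) / (x^3 / (3 * C^4))\<^sup>2"
    proof (intro abs_divide_le abs_mult_le cross_diff DM power_mono)
      show "\<bar>s2 - s1\<bar> \<le> C" using X.s X.s_less by auto
      show "0 < (x^3 / (3 * C^4))\<^sup>2" using x0 X.C_pos by simp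
    qed (use X.D Y.D X.m Y.m pos x X.h2_bounds Y.h2_bounds h2_diff X.W_bounds X.C_pos in auto)
    also have "\<dots> = 72 * C^26 * e / x^3"
      using x0 X.C_pos by (simp add: field_simps eval_nat_numeral)
    finally show "\<bar>(s2 - s1) * (D x / (m x)\<^sup>2) * (D' x / (m' x)\<^sup>2) *
        (X.J x * (Y.h1 x * Y.h2 x) - Y.J x * (X.h1 x * X.h2 x)) / (X.W x)\<^sup>2\<bar> \<le> 72 * C^26 * e / x^3" .
  qed (use sub in auto)
  also have "\<dots> \<le> 36 * C^26 * e / y^2" using e X.C_pos by simp
  finally have 1: "\<bar>Y.W H / X.W H - Y.W y / X.W y\<bar> \<le> 36 * C^26 * e / y^2" .
  have "24 * C^18 * e \<le> 24 * C^26 * e / y^2"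
  proof -
    have "y^2 \<le> C^2" using yH X.H by (intro power_mono) auto
    then have "C^18 * y^2 \<le> C^18 * C^2" using X.C_pos by (intro mult_left_mono) auto
    also have "\<dots> \<le> C^26" using C_power_mono[of 20 26] by (simp flip: power_add)
    finally have "e * (C^18 * y^2) \<le> e * C^26" using e by (rule mult_left_mono)
    then show ?thesis using yH by (simp add: field_simps)
  qed
  then have "\<bar>Y.W H / X.W H - 1\<bar> \<le> 24 * C^26 * e / y^2" using W_ratio_H by linarith
  moreover have "60 * C^26 * e / y^2 = 24 * C^26 * e / y^2 + 36 * C^26 * e / y^2" by (simp add: add_divide_distrib[symmetric])
  ultimately show ?thesis using 1 by linarith
qed

text \<open>The singular orders cancel. The ratio error \<open>e / y^2\<close> meets
  \<open>W h1^2 / J ~ y^2\<close>, and the cross difference \<open>e y^3\<close> meets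
  \<open>W / J^2 ~ y^(-3)\<close>.\<close>

lemma a_diff:
  assumes y: "y \<in> {0<..H}"
  shows "\<bar>Y.a y - X.a y\<bar> \<le> a_const C * e"
proof -
  have y': "y \<in> {0..H}" and y0: "0 < y" using y by auto
  have pos: "0 < X.W y" "0 < X.J y" "0 < Y.J y"
    using X.W_pos X.J_pos Y.J_pos y by auto
  have eq: "Y.a y - X.a y = (Y.W y / X.W y - 1) * (X.W y * (Y.h1 y * Y.h1 y)) / Y.J y +
      X.W y * (X.J y * (Y.h1 y * Y.h1 y) - Y.J y * (X.h1 y * X.h1 y)) / (X.J y * Y.J y)"
    unfolding X.a_eq[OF y] Y.a_eq[OF y] using pos by (simp add: field_simps)
  have "\<bar>(Y.W y / X.W y - 1) * (X.W y * (Y.h1 y * Y.h1 y)) / Y.J y\<bar>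
      \<le> 60 * C^26 * e / y^2 * (C^4 * y^3 * ((C^2 * y) * (C^2 * y))) / (y^3 / (3 * C^7))"
  proof (intro abs_divide_le abs_mult_le W_ratio y)
    show "0 < y^3 / (3 * C^7)" using y0 X.C_pos by simp
  qed (use X.W_bounds[OF y'] pos Y.h1_bounds[OF y'] Y.J_bounds[OF y'] in auto)
  also have "\<dots> = 180 * (C^41 * e)"
    using y0 X.C_pos by (simp add: field_simps eval_nat_numeral)
  finally have 1: "\<bar>(Y.W y / X.W y - 1) * (X.W y * (Y.h1 y * Y.h1 y)) / Y.J y\<bar> \<le> 180 * (C^41 * e)" .
  have "\<bar>X.W y * (X.J y * (Y.h1 y * Y.h1 y) - Y.J y * (X.h1 y * X.h1 y)) / (X.J y * Y.J y)\<bar>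
      \<le> C^4 * y^3 * (8 * C^11 * e * y^3) / (y^3 / (3 * C^7) * (y^3 / (3 * C^7)))"
  proof (intro abs_divide_le abs_mult_le cross_diff y' mult_mono)
    show "0 < y^3 / (3 * C^7) * (y^3 / (3 * C^7))" using y0 X.C_pos by simp
  qed (use X.W_bounds[OF y'] pos X.h1_bounds[OF y'] Y.h1_bounds[OF y'] h1_diff[OF y']
      X.J_bounds[OF y'] Y.J_bounds[OF y'] y0 X.C_pos in auto)
  also have "\<dots> = 72 * (C^29 * e)"
    using y0 X.C_pos by (simp add: field_simps eval_nat_numeral)
  also have "\<dots> \<le> 72 * (C^41 * e)"
    using C_power_mono[of 29 41] e by (intro mult_left_mono mult_right_mono) auto
  finally have 2: "\<bar>X.W y * (X.J y * (Y.h1 y * Y.h1 y) - Y.J y * (X.h1 y * X.h1 y)) / (X.J y * Y.J y)\<bar>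
      \<le> 72 * (C^41 * e)" .
  have "\<bar>Y.a y - X.a y\<bar> \<le> 180 * (C^41 * e) + 72 * (C^41 * e)"
    unfolding eq by (rule order_trans[OF abs_triangle_ineq add_mono[OF 1 2]])
  then show ?thesis by (simp add: a_const_def mult_ac)
qed

lemma a_const_ge_1: "1 \<le> a_const C"
  using one_le_power[OF X.C, of 41] by (simp add: a_const_def)

lemma recip_const_nonneg: "0 \<le> recip_const C H"
  using X.H X.C_pos a_const_ge_1 by (simp add: recip_const_def)

text \<open>This is where \<open>D(H)\<close> and \<open>\<mu>'(H)\<close> have to be known: \<open>h\<^sub>1'(H) = \<mu>'(H) + \<mu>(H) g\<^sub>1(H) / D(H)\<close>.\<close>

lemma g1_diff_H: "\<bar>g1' H - g1 H\<bar> \<le> 4 * C^7 * e"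
proof -
  have HH: "H \<in> {0..H}" using X.H by auto
  have pos: "0 < m H" "0 < m' H" "0 < D H" using X.m_pos Y.m_pos X.D_pos HH by auto
  let ?x = "X.dh1 H - dm H" and ?x' = "Y.dh1 H - dm H"
  have eqs: "g1 H = D H * ?x / m H" "g1' H = D H * ?x' / m' H"
    using pos X.u_H Y.u_H D_H dm_H by (simp_all add: X.dh1_def Y.dh1_def)
  have "g1' H - g1 H = D H * (?x' * (m H - m' H) + m' H * (?x' - ?x)) / (m H * m' H)"
    unfolding eqs using pos by (simp add: field_simps)
  also have "\<bar>\<dots>\<bar> \<le> C * (3 * C^3 * (e * C) + C * e) / (1 / C * (1 / C))"
  proof (intro abs_divide_le abs_mult_le order_trans[OF abs_triangle_ineq] add_mono mult_mono)
    show "\<bar>?x'\<bar> \<le> 3 * C^3"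
      using Y.dh_bounds(1)[OF HH] X.dm[OF HH] C_power_mono[of 1 3] by simp
    show "\<bar>m H - m' H\<bar> \<le> e * C"
      using h1_diff[OF HH] X.u_H Y.u_H mult_left_mono[OF X.H(2) e]
      by (simp add: X.h1_def Y.h1_def)
  qed (use X.D[OF HH] X.m[OF HH] Y.m[OF HH] pos dh1_diff[OF HH] X.C_pos in auto)
  also have "\<dots> = (3 * C^7 + C^4) * e"
    using X.C_pos by (simp add: field_simps eval_nat_numeral)
  also have "\<dots> \<le> 4 * C^7 * e"
    using C_power_mono[of 4 7] e by (intro mult_right_mono) auto
  finally show ?thesis .
qed

text \<open>Subtracting the linear systems for \<open>p\<close> and \<open>r\<close> gives one for
  \<open>P\<close> and \<open>R\<close>. Its forcing is \<open>O(e / t^4)\<close>, from an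
  \<open>O(e)\<close> difference over a product of two \<open>a\<close>, and
  \<open>O(e / t)\<close>, so \<open>singular_gronwall\<close> applies.\<close>

lemma recip_diff:
  assumes y: "y \<in> {0<..H}"
  shows "y^3 * \<bar>1 / u1 y - 1 / u1' y\<bar> \<le> recip_const C H * e"
proof -
  define P where "P y = 1 / u1 y - 1 / u1' y" for y
  define R where "R y = g1' y - g1 y" for y
  let ?K = "a_const C"
  \<comment> \<open>The 2 accommodates two equal contributions to the derivative of
    \<open>R\<close>, one from the data and one from the difference of the \<open>a\<close>.\<close>
  let ?\<beta> = "2 * C^7 * ?K * e"
  have K: "1 \<le> ?K" by (rule a_const_ge_1)
  have recip: "\<bar>1 / u1 t\<bar> \<le> C / t" "\<bar>1 / u1' t\<bar> \<le> C / t" if t: "t \<in> {0<..H}" for t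
    using X.u1(1)[of t] Y.u1(1)[of t] X.u1_pos[OF t] Y.u1_pos[OF t] t X.C_pos
    by (auto simp: field_simps)
  have "y^3 * \<bar>P y\<bar> \<le> 2 * ?\<beta> * (1 + 2 * H) * exp (2 * C^4 * H)"
  proof (rule singular_gronwall[OF X.H(1), where R = R and b = "2 * C^3"])
    fix t assume t: "t \<in> {0<..H}"
    then have t': "t \<in> {0..H}" and t0: "0 < t" by auto
    have sub: "{0<..H} \<subseteq> {0..H}" by auto
    have pos: "0 < u1 t" "0 < u1' t" "0 < D t" "0 < D' t" "0 < X.a t" "0 < Y.a t"
      using X.u1_pos Y.u1_pos X.D_pos Y.D_pos X.a_pos Y.a_pos t t' by auto
    note d = X.deriv_u1[OF t', THEN DERIV_subset, OF sub] Y.deriv_u1[OF t', THEN DERIV_subset, OF sub]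
      X.deriv_g1[OF t', THEN DERIV_subset, OF sub] Y.deriv_g1[OF t', THEN DERIV_subset, OF sub]
    show "(P has_real_derivative R t / X.a t + g1' t * (X.a t - Y.a t) / (X.a t * Y.a t)) (at t within {0<..H})"
    proof -
      have "(P has_real_derivative g1' t / Y.a t - g1 t / X.a t) (at t within {0<..H})"
        unfolding P_def using pos d
        by (auto intro!: derivative_eq_intros simp: X.a_def Y.a_def power2_eq_square)
      then show ?thesis
        by (rule DERIV_cong) (use pos in \<open>simp add: R_def field_simps\<close>)
    qed
    show "(R has_real_derivative
        - ((X.h1 t - Y.h1 t) + s1 * (X.a t * P t + (X.a t - Y.a t) * (1 / u1' t)))) (at t within {0<..H})"
      unfolding R_def by (rule DERIV_cong[OF DERIV_diff[OF d(4) d(3)]])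
        (use pos in \<open>simp add: P_def X.a_def Y.a_def X.h1_def Y.h1_def field_simps power2_eq_square\<close>)
    show "\<bar>R t / X.a t + g1' t * (X.a t - Y.a t) / (X.a t * Y.a t)\<bar> \<le> C^4 * \<bar>R t\<bar> / t^2 + ?\<beta> / t^4"
    proof -
      have "\<bar>R t / X.a t\<bar> \<le> \<bar>R t\<bar> / (t^2 / C^3)"
        using X.a_bounds[OF t'] t0 X.C_pos by (intro abs_divide_le) auto
      also have "\<dots> = C^3 * (\<bar>R t\<bar> / t^2)" by simp
      also have "\<dots> \<le> C^4 * (\<bar>R t\<bar> / t^2)"
        using C_power_mono[of 3 4] by (intro mult_right_mono) auto
      finally have 1: "\<bar>R t / X.a t\<bar> \<le> C^4 * \<bar>R t\<bar> / t^2" by simp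
      have "\<bar>g1' t * (X.a t - Y.a t) / (X.a t * Y.a t)\<bar> \<le> C * (?K * e) / (t^2 / C^3 * (t^2 / C^3))"
      proof (intro abs_divide_le abs_mult_le mult_mono)
        show "0 < t^2 / C^3 * (t^2 / C^3)" using t0 X.C_pos by simp
      qed (use Y.g1[OF t'] a_diff[OF t] X.a_bounds[OF t'] Y.a_bounds[OF t'] pos X.C_pos
          in \<open>auto simp: abs_minus_commute\<close>)
      also have "\<dots> = C^7 * ?K * e / t^4"
        using t0 X.C_pos by (simp add: field_simps eval_nat_numeral)
      also have "\<dots> \<le> ?\<beta> / t^4"
        using t0 X.C_pos K e by (intro divide_right_mono) auto
      finally show ?thesis using 1 abs_triangle_ineq[of "R t / X.a t"] by (meson add_mono order_trans)
    qed
    show "\<bar>- ((X.h1 t - Y.h1 t) + s1 * (X.a t * P t + (X.a t - Y.a t) * (1 / u1' t)))\<bar>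
        \<le> C^4 * t^2 * \<bar>P t\<bar> + ?\<beta> / t"
    proof -
      have "\<bar>s1 * (X.a t * P t + (X.a t - Y.a t) * (1 / u1' t))\<bar>
          \<le> C * ((C^3 * t^2) * \<bar>P t\<bar> + (?K * e) * (C / t))"
        using X.s X.a_bounds[OF t'] pos a_diff[OF t] recip[OF t]
        by (intro abs_mult_le order_trans[OF abs_triangle_ineq] add_mono) (auto simp: abs_minus_commute)
      also have "\<dots> = C^4 * t^2 * \<bar>P t\<bar> + C^2 * ?K * e / t"
        by (simp add: eval_nat_numeral algebra_simps)
      also have "C^2 * ?K * e / t \<le> C^7 * ?K * e / t"
        using C_power_mono[of 2 7] K e t0 by (intro divide_right_mono mult_right_mono) auto
      finally have 1: "\<bar>s1 * (X.a t * P t + (X.a t - Y.a t) * (1 / u1' t))\<bar>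
          \<le> C^4 * t^2 * \<bar>P t\<bar> + C^7 * ?K * e / t" by simp
      have "t * t \<le> C * C" using t X.H by (intro mult_mono) auto
      also have "\<dots> \<le> C^7 * 1" using C_power_mono[of 2 7] by (simp add: power2_eq_square)
      also have "\<dots> \<le> C^7 * ?K" using K X.C_pos by (intro mult_left_mono) auto
      finally have "e * (t * t) \<le> e * (C^7 * ?K)" using e by (rule mult_left_mono)
      then have "e * t \<le> C^7 * ?K * e / t" using t0 by (simp add: field_simps)
      then have "\<bar>X.h1 t - Y.h1 t\<bar> \<le> C^7 * ?K * e / t" using h1_diff[OF t'] by linarith
      then have "\<bar>(X.h1 t - Y.h1 t) + s1 * (X.a t * P t + (X.a t - Y.a t) * (1 / u1' t))\<bar>
          \<le> C^7 * ?K * e / t + (C^4 * t^2 * \<bar>P t\<bar> + C^7 * ?K * e / t)"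
        using 1 by (rule order_trans[OF abs_triangle_ineq add_mono])
      also have "\<dots> = C^4 * t^2 * \<bar>P t\<bar> + ?\<beta> / t" by simp
      finally show ?thesis unfolding abs_minus_cancel .
    qed
    show "t^3 * \<bar>P t\<bar> \<le> 2 * C^3"
    proof -
      have "t^3 * \<bar>P t\<bar> \<le> t^3 * (C / t + C / t)"
        unfolding P_def using recip[OF t] t0
        by (intro mult_left_mono order_trans[OF abs_triangle_ineq4] add_mono) auto
      also have "\<dots> = 2 * C * (t * t)" using t0 by (simp add: field_simps eval_nat_numeral)
      also have "\<dots> \<le> 2 * C * (C * C)" using t X.H X.C_pos by (intro mult_left_mono mult_mono) auto
      finally show ?thesis by (simp add: eval_nat_numeral)
    qed
    show "t * \<bar>R t\<bar> \<le> 2 * C^3"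
    proof -
      have "t * \<bar>R t\<bar> \<le> C * (C + C)"
        unfolding R_def using t X.H X.C_pos X.g1[OF t'] Y.g1[OF t']
        by (intro mult_mono order_trans[OF abs_triangle_ineq4] add_mono) auto
      also have "\<dots> = 2 * C^2" by (simp add: power2_eq_square)
      also have "\<dots> \<le> 2 * C^3" using C_power_mono[of 2 3] by simp
      finally show ?thesis .
    qed
  next
    \<comment> \<open>\<open>a_const C\<close> is at least 2, so \<open>?\<beta>\<close> also
      dominates the flux difference at \<open>H\<close>.\<close>
    have "4 * (C^7 * e) \<le> 2 * a_const C * (C^7 * e)"
      using one_le_power[OF X.C, of 41] X.C_pos e unfolding a_const_def by (intro mult_right_mono) auto
    then show "\<bar>R H\<bar> \<le> ?\<beta>" using g1_diff_H by (simp add: R_def mult_ac)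
  qed (use X.C_pos K e y X.u_H Y.u_H in \<open>auto simp: P_def\<close>)
  then show ?thesis by (simp add: P_def recip_const_def mult_ac)
qed

text \<open>From \<open>D = a p^2\<close> and \<open>m = h1 p\<close>. The worst terms are
  \<open>(a - a') p^2\<close>, \<open>a' (p - p') (p + p')\<close> and \<open>h1' (p - p')\<close>,
  each \<open>O(e / y^2)\<close>, which the factor \<open>y^2\<close> compensates.\<close>

lemma coefficient_diff:
  assumes y: "y \<in> {0<..H}"
  defines "K \<equiv> C^2 * a_const C + 2 * C^4 * recip_const C H + C^3"
  shows "y^2 * \<bar>D y - D' y\<bar> \<le> K * e" "y^2 * \<bar>m y - m' y\<bar> \<le> K * e"
proof -
  have y': "y \<in> {0..H}" and y0: "0 < y" using y by auto
  let ?p = "1 / u1 y" and ?p' = "1 / u1' y"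
  have pos: "0 < u1 y" "0 < u1' y" "0 < X.a y" "0 < Y.a y"
    using X.u1_pos Y.u1_pos X.a_pos Y.a_pos y by auto
  have recip: "\<bar>?p\<bar> \<le> C / y" "\<bar>?p'\<bar> \<le> C / y"
    using X.u1(1)[OF y'] Y.u1(1)[OF y'] pos y0 X.C_pos by (auto simp: field_simps)
  note rd = recip_diff[OF y]
  have nn: "0 \<le> C^2 * a_const C * e" "0 \<le> C^3 * e" "0 \<le> recip_const C H * e"
    using X.C_pos a_const_ge_1 recip_const_nonneg e by auto
  have "D y - D' y = (X.a y - Y.a y) * (?p * ?p) + Y.a y * ((?p - ?p') * (?p + ?p'))"
    using pos by (simp add: X.a_def Y.a_def field_simps power2_eq_square)
  also have "\<bar>\<dots>\<bar> \<le> a_const C * e * (C / y * (C / y)) + C^3 * y^2 * (\<bar>?p - ?p'\<bar> * (C / y + C / y))"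
    using a_diff[OF y] recip Y.a_bounds[OF y'] pos
    by (intro abs_mult_le order_trans[OF abs_triangle_ineq] add_mono) (auto simp: abs_minus_commute)
  finally have "y^2 * \<bar>D y - D' y\<bar> \<le>
      y^2 * (a_const C * e * (C / y * (C / y)) + C^3 * y^2 * (\<bar>?p - ?p'\<bar> * (C / y + C / y)))"
    by (intro mult_left_mono) auto
  also have "\<dots> = C^2 * a_const C * e + 2 * C^4 * (y^3 * \<bar>?p - ?p'\<bar>)"
    using y0 by (simp add: field_simps eval_nat_numeral)
  also have "\<dots> \<le> C^2 * a_const C * e + 2 * C^4 * (recip_const C H * e)"
    using rd X.C_pos by (intro add_left_mono mult_left_mono) auto
  also have "\<dots> \<le> K * e" using nn by (simp add: K_def algebra_simps)
  finally show "y^2 * \<bar>D y - D' y\<bar> \<le> K * e" .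
  have "m y - m' y = (X.h1 y - Y.h1 y) * ?p + Y.h1 y * (?p - ?p')"
    using pos by (simp add: X.h1_def Y.h1_def field_simps)
  also have "\<bar>\<dots>\<bar> \<le> e * y * (C / y) + C^2 * y * \<bar>?p - ?p'\<bar>"
    using h1_diff[OF y'] recip Y.h1_bounds[OF y']
    by (intro abs_mult_le order_trans[OF abs_triangle_ineq] add_mono) auto
  finally have "y^2 * \<bar>m y - m' y\<bar> \<le> y^2 * (e * y * (C / y) + C^2 * y * \<bar>?p - ?p'\<bar>)"
    by (intro mult_left_mono) auto
  also have "\<dots> = C * e * (y * y) + C^2 * (y^3 * \<bar>?p - ?p'\<bar>)"
    using y0 by (simp add: field_simps eval_nat_numeral)
  also have "\<dots> \<le> C * e * (C * C) + C^4 * (recip_const C H * e)"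
  proof (rule add_mono)
    show "C * e * (y * y) \<le> C * e * (C * C)"
      using y X.H X.C_pos e by (intro mult_left_mono mult_mono) auto
    show "C^2 * (y^3 * \<bar>?p - ?p'\<bar>) \<le> C^4 * (recip_const C H * e)"
      by (rule mult_mono[OF _ rd]) (use y0 X.C_pos C_power_mono[of 2 4] in auto)
  qed
  also have "\<dots> \<le> C * e * (C * C) + 2 * C^4 * (recip_const C H * e)"
    using X.C_pos nn(3) by (intro add_left_mono mult_right_mono) auto
  also have "\<dots> \<le> K * e" using nn by (simp add: K_def eval_nat_numeral algebra_simps)
  finally show "y^2 * \<bar>m y - m' y\<bar> \<le> K * e" .
qed

end

section \<open>Passage from the boundary value problem and the norms to the abstract setting\<close>

text \<open>Integrating the derivative from the zero at \<open>0\<close> supplies the factor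
  \<open>y\<close> that \<open>flux_pair\<close> demands.\<close>

lemma Ck_1_bounds:
  assumes "0 < H" and f: "\<And>y. y \<in> {0..H} \<Longrightarrow> (f has_real_derivative f' y) (at y within {0..H})"
    and cont: "continuous_on {0..H} f'" and "f 0 = 0" and y: "y \<in> {0..H}"
  shows "\<bar>f' y\<bar> \<le> Ck_norm 1 H f" "\<bar>f y\<bar> \<le> Ck_norm 1 H f * y"
proof -
  have d: "deriv_on H f x = f' x" if "x \<in> {0..H}" for x
    by (rule deriv_on_eqI[OF assms(1) that f[OF that]])
  have "continuous_on {0..H} (deriv_on H f)"
    using cont d continuous_on_cong[of "{0..H}" "{0..H}" "deriv_on H f" f'] by simp
  moreover have "f differentiable_on {0..H}"
    using f unfolding differentiable_on_def by (meson real_differentiable_def)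
  ultimately have "f \<in> Ck 1 H" by (simp add: Ck_def)
  then have le: "\<bar>f' x\<bar> \<le> Ck_norm 1 H f" if "x \<in> {0..H}" for x
    using Ck_norm_ge[OF assms(1), of f 1 1 x] d that by simp
  then show "\<bar>f' y\<bar> \<le> Ck_norm 1 H f" using y .
  have "\<bar>f y - f 0\<bar> \<le> Ck_norm 1 H f * y - Ck_norm 1 H f * 0"
  proof (rule abs_deriv_le_imp_abs_diff_le[OF _ _ f])
    fix x
    show "((*) (Ck_norm 1 H f) has_real_derivative Ck_norm 1 H f) (at x within {0..H})"
      by (auto intro!: derivative_eq_intros)
  qed (use y le in auto)
  then show "\<bar>f y\<bar> \<le> Ck_norm 1 H f * y" using assms by simp
qed

text \<open>\<open>C\<close> is fixed before the coefficients and solutions are chosen: it is the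
  maximum of finitely many numbers built from the a priori data and the two frequencies.\<close>

lemma admissible_flux_system:
  assumes "0 < H" "0 < D\<^sub>0" "0 < \<mu>\<^sub>0" "max D\<^sub>0 \<mu>\<^sub>0 < M" "l\<^sub>1\<^sup>2 < l\<^sub>2\<^sup>2"
  obtains C where "\<And>D \<mu> u\<^sub>1 u\<^sub>2. \<lbrakk>(D, \<mu>) \<in> admissible H D\<^sub>0 \<mu>\<^sub>0 M;
      bvp_solution H D \<mu> l\<^sub>1 u\<^sub>1; bvp_solution H D \<mu> l\<^sub>2 u\<^sub>2\<rbrakk> \<Longrightarrow>
      \<exists>g\<^sub>1 g\<^sub>2. flux_system H C (l\<^sub>1\<^sup>2) (l\<^sub>2\<^sup>2) D \<mu> (deriv_on H \<mu>) u\<^sub>1 u\<^sub>2 g\<^sub>1 g\<^sub>2"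
proof -
  obtain C1 C2 where C1: "flux_bound H D\<^sub>0 M (l\<^sub>1\<^sup>2) C1" and C2: "flux_bound H D\<^sub>0 M (l\<^sub>2\<^sup>2) C2"
    using ex_flux_bound[of H D\<^sub>0 M "l\<^sub>1\<^sup>2"] ex_flux_bound[of H D\<^sub>0 M "l\<^sub>2\<^sup>2"] assms by auto
  define A where "A = {1, H, 1 / H, M, 1 / D\<^sub>0, 1 / \<mu>\<^sub>0, l\<^sub>1\<^sup>2, l\<^sub>2\<^sup>2 - l\<^sub>1\<^sup>2, 1 / (l\<^sub>2\<^sup>2 - l\<^sub>1\<^sup>2), C1, C2}"
  define C where "C = Max A"
  have C_ge: "x \<le> C" if "x \<in> A" for x
    unfolding C_def using that by (intro Max_ge) (auto simp: A_def)
  have C: "1 \<le> C" "H \<le> C" "1 / H \<le> C" "M \<le> C" "1 / D\<^sub>0 \<le> C" "1 / \<mu>\<^sub>0 \<le> C" "l\<^sub>1\<^sup>2 \<le> C"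
    "l\<^sub>2\<^sup>2 - l\<^sub>1\<^sup>2 \<le> C" "1 / (l\<^sub>2\<^sup>2 - l\<^sub>1\<^sup>2) \<le> C" "C1 \<le> C" "C2 \<le> C"
    by (rule C_ge; simp add: A_def)+
  have inv: "1 / C \<le> x" if "1 / x \<le> C" "0 < x" for x
    using that C(1) by (simp add: field_simps)
  show thesis
  proof (rule that[of C])
    fix D \<mu> u\<^sub>1 u\<^sub>2
    assume adm: "(D, \<mu>) \<in> admissible H D\<^sub>0 \<mu>\<^sub>0 M"
      and sol: "bvp_solution H D \<mu> l\<^sub>1 u\<^sub>1" "bvp_solution H D \<mu> l\<^sub>2 u\<^sub>2"
    have Ck: "D \<in> Ck 3 H" "\<mu> \<in> Ck 3 H" and norm: "Ck_norm 3 H D \<le> M" "Ck_norm 3 H \<mu> \<le> M"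
      and lower: "\<And>y. y \<in> {0..H} \<Longrightarrow> D\<^sub>0 < D y" "\<And>y. y \<in> {0..H} \<Longrightarrow> \<mu>\<^sub>0 < \<mu> y"
      using adm by (auto simp: admissible_def)
    have cont: "continuous_on {0..H} D" "continuous_on {0..H} \<mu>" "continuous_on {0..H} (deriv_on H \<mu>)"
      using Ck_continuous[OF Ck(1), of 0] Ck_continuous[OF Ck(2), of 0] Ck_continuous[OF Ck(2), of 1]
      by simp_all
    have upper: "D y \<le> M" "\<mu> y \<le> M" "\<bar>deriv_on H \<mu> y\<bar> \<le> M" if "y \<in> {0..H}" for y
      using Ck_norm_ge[OF assms(1) Ck(1), of 0 y] Ck_norm_ge[OF assms(1) Ck(2), of 0 y]
        Ck_norm_ge[OF assms(1) Ck(2), of 1 y] norm that by auto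
    have pos: "0 < D y" "0 < \<mu> y" if "y \<in> {0..H}" for y
      using lower[OF that] assms by auto
    obtain g\<^sub>1 where g1:
      "\<And>y. y \<in> {0..H} \<Longrightarrow> (u\<^sub>1 has_real_derivative g\<^sub>1 y / D y) (at y within {0..H})"
      "\<And>y. y \<in> {0..H} \<Longrightarrow> (g\<^sub>1 has_real_derivative (\<mu> y + l\<^sub>1\<^sup>2 * D y) * u\<^sub>1 y) (at y within {0..H})"
      using bvp_solution_flux[OF assms(1) cont(1) pos(1) cont(2) sol(1)] by blast
    obtain g\<^sub>2 where g2:
      "\<And>y. y \<in> {0..H} \<Longrightarrow> (u\<^sub>2 has_real_derivative g\<^sub>2 y / D y) (at y within {0..H})"
      "\<And>y. y \<in> {0..H} \<Longrightarrow> (g\<^sub>2 has_real_derivative (\<mu> y + l\<^sub>2\<^sup>2 * D y) * u\<^sub>2 y) (at y within {0..H})"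
      using bvp_solution_flux[OF assms(1) cont(1) pos(1) cont(2) sol(2)] by blast
    have bc: "u\<^sub>1 0 = 0" "u\<^sub>1 H = 1" "u\<^sub>2 0 = 0" "u\<^sub>2 H = 1"
      using sol by (auto simp: bvp_solution_def)
    have enlarge: "y / C \<le> u y \<and> u y \<le> C * y \<and> \<bar>g y\<bar> \<le> C"
      if *: "\<And>y. y \<in> {0..H} \<Longrightarrow> y \<le> c * u y \<and> u y \<le> c * y \<and> \<bar>g y\<bar> \<le> c"
        and "u H = 1" "c \<le> C" and y: "y \<in> {0..H}" for c u g y
    proof -
      \<comment> \<open>At \<open>y = H\<close> the hypothesis reads
        \<open>H \<le> c\<close>.\<close>
      have c: "0 < c" using *[of H] \<open>u H = 1\<close> assms by auto
      have "0 \<le> y / c" using c y by simp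
      also have "\<dots> \<le> u y" using *[OF y] c by (simp add: field_simps)
      finally have "c * u y \<le> C * u y" using \<open>c \<le> C\<close> by (rule mult_right_mono[rotated])
      moreover have "c * y \<le> C * y" using y \<open>c \<le> C\<close> by (intro mult_right_mono) auto
      ultimately have "y \<le> C * u y" "u y \<le> C * y" "\<bar>g y\<bar> \<le> C" using *[OF y] \<open>c \<le> C\<close> by auto
      then show ?thesis using C(1) by (simp add: field_simps)
    qed
    have b1: "y / C \<le> u\<^sub>1 y \<and> u\<^sub>1 y \<le> C * y \<and> \<bar>g\<^sub>1 y\<bar> \<le> C" if "y \<in> {0..H}" for y
    proof (rule enlarge[of C1 u\<^sub>1 g\<^sub>1, OF _ bc(2) C(10) that])
      show "x \<le> C1 * u\<^sub>1 x \<and> u\<^sub>1 x \<le> C1 * x \<and> \<bar>g\<^sub>1 x\<bar> \<le> C1" if "x \<in> {0..H}" for x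
        using C1[unfolded flux_bound_def, rule_format, of D \<mu> u\<^sub>1 g\<^sub>1 x] lower pos upper g1 bc that
        by (simp add: less_imp_le)
    qed
    have b2: "y / C \<le> u\<^sub>2 y \<and> u\<^sub>2 y \<le> C * y \<and> \<bar>g\<^sub>2 y\<bar> \<le> C" if "y \<in> {0..H}" for y
    proof (rule enlarge[of C2 u\<^sub>2 g\<^sub>2, OF _ bc(4) C(11) that])
      show "x \<le> C2 * u\<^sub>2 x \<and> u\<^sub>2 x \<le> C2 * x \<and> \<bar>g\<^sub>2 x\<bar> \<le> C2" if "x \<in> {0..H}" for x
        using C2[unfolded flux_bound_def, rule_format, of D \<mu> u\<^sub>2 g\<^sub>2 x] lower pos upper g2 bc that
        by (simp add: less_imp_le)
    qed
    have "flux_system H C (l\<^sub>1\<^sup>2) (l\<^sub>2\<^sup>2) D \<mu> (deriv_on H \<mu>) u\<^sub>1 u\<^sub>2 g\<^sub>1 g\<^sub>2"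
    proof
      show "1 / C \<le> H" "1 / C \<le> l\<^sub>2\<^sup>2 - l\<^sub>1\<^sup>2" using C assms by (auto intro: inv)
      show "1 / C \<le> D y" "1 / C \<le> \<mu> y" if "y \<in> {0..H}" for y
        using inv[of D\<^sub>0] inv[of \<mu>\<^sub>0] C assms lower[OF that] by auto
      show "D y \<le> C" "\<mu> y \<le> C" "\<bar>deriv_on H \<mu> y\<bar> \<le> C" if "y \<in> {0..H}" for y
        using upper[OF that] C by auto
      show "(\<mu> has_real_derivative deriv_on H \<mu> y) (at y within {0..H})" if "y \<in> {0..H}" for y
        using Ck_has_derivative[OF assms(1) Ck(2) _ that] by simp
    qed (use C assms cont g1 g2 bc b1 b2 in auto)
    then show "\<exists>g\<^sub>1 g\<^sub>2. flux_system H C (l\<^sub>1\<^sup>2) (l\<^sub>2\<^sup>2) D \<mu> (deriv_on H \<mu>) u\<^sub>1 u\<^sub>2 g\<^sub>1 g\<^sub>2"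
      by blast
  qed
qed

text \<open>The coefficient ratio is at most \<open>M / D\<^sub>0\<close>, and the quotient of sinh
  is at most \<open>y / H\<close> for every real argument, hence for either sign of
  \<open>kappa_m\<close>.\<close>

lemma u_m_sq_le:
  assumes "0 < H" "0 < D\<^sub>0" "\<And>y. y \<in> {0..H} \<Longrightarrow> D\<^sub>0 \<le> D y" "D H \<le> M" "y \<in> {0..H}"
  shows "(u_m H D \<mu> l y)\<^sup>2 \<le> M / (D\<^sub>0 * H\<^sup>2) * y\<^sup>2"
proof -
  let ?s = "sqrt (kappa_m H D \<mu> l)"
  have "D\<^sub>0 \<le> D y" "D\<^sub>0 \<le> D H" using assms by auto
  then have "0 \<le> M" using assms by linarith
  have "(u_m H D \<mu> l y)\<^sup>2 = D H / D y * (sinh (?s * y) / sinh (?s * H))\<^sup>2"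
    using \<open>D\<^sub>0 \<le> D y\<close> \<open>D\<^sub>0 \<le> D H\<close> assms(2) by (simp add: u_m_def power_mult_distrib power_divide)
  also have "\<dots> \<le> M / D\<^sub>0 * (y / H)\<^sup>2"
  proof (intro mult_mono power_mono)
    show "D H / D y \<le> M / D\<^sub>0"
      using \<open>D\<^sub>0 \<le> D y\<close> \<open>0 \<le> M\<close> assms by (intro frac_le) auto
  qed (use sinh_ratio_le[of H y ?s] \<open>0 \<le> M\<close> assms in auto)
  finally show ?thesis by (simp add: power_divide)
qed

theorem theorem4p1:
  fixes L H D\<^sub>0 \<mu>\<^sub>0 M :: real
  assumes "L > 0" and "H > 0" and "D\<^sub>0 > 0" and "\<mu>\<^sub>0 > 0" and "M > max D\<^sub>0 \<mu>\<^sub>0"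
  shows "\<exists>k\<^sub>0::int. \<forall>k\<^sub>1 k\<^sub>2. k\<^sub>0 \<le> k\<^sub>1 \<and> k\<^sub>1 < k\<^sub>2 \<longrightarrow>
    (\<exists>C>0. \<forall>D \<mu> D' \<mu>' u\<^sub>1 u\<^sub>2 u\<^sub>1' u\<^sub>2'.
       (D, \<mu>) \<in> admissible H D\<^sub>0 \<mu>\<^sub>0 M \<and> (D', \<mu>') \<in> admissible H D\<^sub>0 \<mu>\<^sub>0 M \<and>
       D H = D' H \<and> deriv_on H D H = deriv_on H D' H \<and> deriv_on H \<mu> H = deriv_on H \<mu>' H \<and>
       bvp_solution H D \<mu> (freq L k\<^sub>1) u\<^sub>1 \<and> bvp_solution H D \<mu> (freq L k\<^sub>2) u\<^sub>2 \<and>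
       bvp_solution H D' \<mu>' (freq L k\<^sub>1) u\<^sub>1' \<and> bvp_solution H D' \<mu>' (freq L k\<^sub>2) u\<^sub>2' \<longrightarrow>
       (let h\<^sub>1 = (\<lambda>y. \<mu> y * u\<^sub>1 y); h\<^sub>2 = (\<lambda>y. \<mu> y * u\<^sub>2 y);
            h\<^sub>1' = (\<lambda>y. \<mu>' y * u\<^sub>1' y); h\<^sub>2' = (\<lambda>y. \<mu>' y * u\<^sub>2' y);
            B = C * (Ck_norm 1 H (\<lambda>y. h\<^sub>1 y - h\<^sub>1' y) + Ck_norm 1 H (\<lambda>y. h\<^sub>2 y - h\<^sub>2' y));
            w = u_m H D \<mu> (freq L k\<^sub>1)
        in Ck_norm 0 H (\<lambda>y. (w y)\<^sup>2 * (D y - D' y)) \<le> B \<and>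
           Ck_norm 0 H (\<lambda>y. (w y)\<^sup>2 * (\<mu> y - \<mu>' y)) \<le> B))"
\<comment> \<open>The threshold 0 makes the frequencies nonnegative and their squares strictly
  increasing.\<close>
proof (rule exI[of _ 0], intro allI impI, goal_cases)
  case (1 k\<^sub>1 k\<^sub>2)
  define l\<^sub>1 l\<^sub>2 where "l\<^sub>1 = freq L k\<^sub>1" and "l\<^sub>2 = freq L k\<^sub>2"
  have "0 \<le> l\<^sub>1" "l\<^sub>1 < l\<^sub>2" using 1 assms by (auto simp: l\<^sub>1_def l\<^sub>2_def freq_def divide_strict_right_mono)
  then have "l\<^sub>1\<^sup>2 < l\<^sub>2\<^sup>2" by (intro power_strict_mono) auto
  obtain C where C: "\<And>D \<mu> u\<^sub>1 u\<^sub>2. \<lbrakk>(D, \<mu>) \<in> admissible H D\<^sub>0 \<mu>\<^sub>0 M;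
      bvp_solution H D \<mu> l\<^sub>1 u\<^sub>1; bvp_solution H D \<mu> l\<^sub>2 u\<^sub>2\<rbrakk> \<Longrightarrow>
      \<exists>g\<^sub>1 g\<^sub>2. flux_system H C (l\<^sub>1\<^sup>2) (l\<^sub>2\<^sup>2) D \<mu> (deriv_on H \<mu>) u\<^sub>1 u\<^sub>2 g\<^sub>1 g\<^sub>2"
    by (rule admissible_flux_system[OF assms(2-5) \<open>l\<^sub>1\<^sup>2 < l\<^sub>2\<^sup>2\<close>]) blast
  define K where "K = C^2 * a_const C + 2 * C^4 * recip_const C H + C^3"
  \<comment> \<open>The constant of the weight times that of \<open>coefficient_diff\<close>. The
    absolute value is taken because the sign of \<open>C\<close> is not yet available here; the
    summand 1 ensures strict positivity.\<close>
  define B where "B = M / (D\<^sub>0 * H\<^sup>2) * \<bar>K\<bar> + 1"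
  have M: "0 < M" using assms by simp
  then have fac: "0 \<le> M / (D\<^sub>0 * H\<^sup>2)" using assms by simp
  have B: "0 < B" unfolding B_def by (intro add_nonneg_pos mult_nonneg_nonneg fac) auto
  show ?case
  proof (rule exI[of _ B], rule conjI[OF B], intro allI impI, goal_cases)
    case (1 D \<mu> D' \<mu>' u\<^sub>1 u\<^sub>2 u\<^sub>1' u\<^sub>2')
    then have adm: "(D, \<mu>) \<in> admissible H D\<^sub>0 \<mu>\<^sub>0 M" "(D', \<mu>') \<in> admissible H D\<^sub>0 \<mu>\<^sub>0 M"
      and eq_H: "D H = D' H" "deriv_on H \<mu> H = deriv_on H \<mu>' H"
      and sol: "bvp_solution H D \<mu> l\<^sub>1 u\<^sub>1" "bvp_solution H D \<mu> l\<^sub>2 u\<^sub>2"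
        "bvp_solution H D' \<mu>' l\<^sub>1 u\<^sub>1'" "bvp_solution H D' \<mu>' l\<^sub>2 u\<^sub>2'"
      by (simp_all add: l\<^sub>1_def l\<^sub>2_def)
    obtain g\<^sub>1 g\<^sub>2 where X: "flux_system H C (l\<^sub>1\<^sup>2) (l\<^sub>2\<^sup>2) D \<mu> (deriv_on H \<mu>) u\<^sub>1 u\<^sub>2 g\<^sub>1 g\<^sub>2"
      using C[OF adm(1) sol(1,2)] by auto
    obtain g\<^sub>1' g\<^sub>2' where Y: "flux_system H C (l\<^sub>1\<^sup>2) (l\<^sub>2\<^sup>2) D' \<mu>' (deriv_on H \<mu>') u\<^sub>1' u\<^sub>2' g\<^sub>1' g\<^sub>2'"
      using C[OF adm(2) sol(3,4)] by auto
    interpret X: flux_system H C "l\<^sub>1\<^sup>2" "l\<^sub>2\<^sup>2" D \<mu> "deriv_on H \<mu>" u\<^sub>1 u\<^sub>2 g\<^sub>1 g\<^sub>2 by (rule X)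
    interpret Y: flux_system H C "l\<^sub>1\<^sup>2" "l\<^sub>2\<^sup>2" D' \<mu>' "deriv_on H \<mu>'" u\<^sub>1' u\<^sub>2' g\<^sub>1' g\<^sub>2' by (rule Y)
    define e\<^sub>1 where "e\<^sub>1 = Ck_norm 1 H (\<lambda>y. \<mu> y * u\<^sub>1 y - \<mu>' y * u\<^sub>1' y)"
    define e\<^sub>2 where "e\<^sub>2 = Ck_norm 1 H (\<lambda>y. \<mu> y * u\<^sub>2 y - \<mu>' y * u\<^sub>2' y)"
    have h1: "\<bar>X.dh1 y - Y.dh1 y\<bar> \<le> e\<^sub>1 \<and> \<bar>X.h1 y - Y.h1 y\<bar> \<le> e\<^sub>1 * y"
      and h2: "\<bar>X.dh2 y - Y.dh2 y\<bar> \<le> e\<^sub>2 \<and> \<bar>X.h2 y - Y.h2 y\<bar> \<le> e\<^sub>2 * y" if "y \<in> {0..H}" for y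
      using Ck_1_bounds[OF X.H(1) DERIV_diff[OF X.deriv_h(1) Y.deriv_h(1)]
          continuous_on_diff[OF X.continuous_on_dh(1) Y.continuous_on_dh(1)] _ that]
        Ck_1_bounds[OF X.H(1) DERIV_diff[OF X.deriv_h(2) Y.deriv_h(2)]
          continuous_on_diff[OF X.continuous_on_dh(2) Y.continuous_on_dh(2)] _ that]
        X.u_0 Y.u_0
      by (simp_all add: e\<^sub>1_def e\<^sub>2_def X.h1_def X.h2_def Y.h1_def Y.h2_def)
    have e: "0 \<le> e\<^sub>1" "0 \<le> e\<^sub>2"
      using h1[of H] h2[of H] X.H by (auto intro: order_trans[OF abs_ge_zero])
    have mono: "\<bar>x\<bar> \<le> e\<^sub>1 * y \<Longrightarrow> \<bar>x\<bar> \<le> (e\<^sub>1 + e\<^sub>2) * y" "\<bar>x\<bar> \<le> e\<^sub>2 * y \<Longrightarrow> \<bar>x\<bar> \<le> (e\<^sub>1 + e\<^sub>2) * y"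
      if "y \<in> {0..H}" for x y
    proof -
      have "0 \<le> e\<^sub>1 * y" "0 \<le> e\<^sub>2 * y" using e that by auto
      then show "\<bar>x\<bar> \<le> e\<^sub>1 * y \<Longrightarrow> \<bar>x\<bar> \<le> (e\<^sub>1 + e\<^sub>2) * y" "\<bar>x\<bar> \<le> e\<^sub>2 * y \<Longrightarrow> \<bar>x\<bar> \<le> (e\<^sub>1 + e\<^sub>2) * y"
        unfolding distrib_right by linarith+
    qed
    interpret flux_pair H C "l\<^sub>1\<^sup>2" "l\<^sub>2\<^sup>2" D \<mu> "deriv_on H \<mu>" u\<^sub>1 u\<^sub>2 g\<^sub>1 g\<^sub>2
      D' \<mu>' "deriv_on H \<mu>'" u\<^sub>1' u\<^sub>2' g\<^sub>1' g\<^sub>2' "e\<^sub>1 + e\<^sub>2"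
    proof
      fix y assume y: "y \<in> {0..H}"
      show "\<bar>X.h1 y - Y.h1 y\<bar> \<le> (e\<^sub>1 + e\<^sub>2) * y" "\<bar>X.h2 y - Y.h2 y\<bar> \<le> (e\<^sub>1 + e\<^sub>2) * y"
        using h1[OF y] h2[OF y] mono[OF y] by auto
      show "\<bar>X.dh1 y - Y.dh1 y\<bar> \<le> e\<^sub>1 + e\<^sub>2" "\<bar>X.dh2 y - Y.dh2 y\<bar> \<le> e\<^sub>1 + e\<^sub>2"
        using h1[OF y] h2[OF y] e by auto
    qed (use e eq_H in auto)
    have D_lower: "D\<^sub>0 \<le> D y" if "y \<in> {0..H}" for y
      using adm(1) that by (auto simp: admissible_def intro: less_imp_le)
    have D_H: "D H \<le> M"
      using adm(1) Ck_norm_ge[of H D 3 0 H] X.H by (auto simp: admissible_def)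
    \<comment> \<open>The estimate for \<open>d\<close> is required only away from \<open>0\<close>,
      since \<open>y\<^sup>2 * \<bar>d\<bar>\<close> vanishes at \<open>0\<close>.\<close>
    have weighted: "\<bar>(u_m H D \<mu> l\<^sub>1 y)\<^sup>2 * d\<bar> \<le> B * (e\<^sub>1 + e\<^sub>2)"
      if "y \<in> {0..H}" "y \<noteq> 0 \<Longrightarrow> y\<^sup>2 * \<bar>d\<bar> \<le> K * (e\<^sub>1 + e\<^sub>2)" for y d
    proof -
      have "y\<^sup>2 * \<bar>d\<bar> \<le> \<bar>K\<bar> * (e\<^sub>1 + e\<^sub>2)"
        using that(2) e mult_right_mono[OF abs_ge_self[of K], of "e\<^sub>1 + e\<^sub>2"] by (cases "y = 0") auto
      then have "M / (D\<^sub>0 * H\<^sup>2) * (y\<^sup>2 * \<bar>d\<bar>) \<le> M / (D\<^sub>0 * H\<^sup>2) * (\<bar>K\<bar> * (e\<^sub>1 + e\<^sub>2))"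
        using fac by (rule mult_left_mono)
      moreover have "(u_m H D \<mu> l\<^sub>1 y)\<^sup>2 * \<bar>d\<bar> \<le> M / (D\<^sub>0 * H\<^sup>2) * y\<^sup>2 * \<bar>d\<bar>"
        using u_m_sq_le[where D = D, OF assms(2,3) D_lower D_H that(1)] by (intro mult_right_mono) auto
      ultimately show ?thesis using e by (simp add: abs_mult B_def distrib_right mult.assoc)
    qed
    have sup: "Ck_norm 0 H f \<le> B * (e\<^sub>1 + e\<^sub>2)"
      if "\<And>y. y \<in> {0..H} \<Longrightarrow> \<bar>f y\<bar> \<le> B * (e\<^sub>1 + e\<^sub>2)" for f
      unfolding Ck_norm_def using that X.H by (auto intro!: cSUP_least)
    show ?case
      unfolding Let_def e\<^sub>1_def[symmetric] e\<^sub>2_def[symmetric] l\<^sub>1_def[symmetric]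
    proof (intro conjI sup weighted)
      fix y assume "y \<in> {0..H}" "y \<noteq> 0"
      then have "y \<in> {0<..H}" by auto
      from coefficient_diff[OF this]
      show "y\<^sup>2 * \<bar>D y - D' y\<bar> \<le> K * (e\<^sub>1 + e\<^sub>2)" "y\<^sup>2 * \<bar>\<mu> y - \<mu>' y\<bar> \<le> K * (e\<^sub>1 + e\<^sub>2)"
        unfolding K_def .
    qed
  qed
qed

end
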